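(* Let $F$ be a field and $n\geq 1$. The $\mathbf{Q}$-vector space $\mathcal{G}_n(F)$ (the weight $n$ part of the Goncharov Lie coalgebra of $F$) is presented by the generators $\operatorname{Cor}(x_0,\dots,x_n)$, where $x_0,\dots,x_n\in F$ are not all equal, and the decomposition relations alone: for all tuples $(x_0,\dots,x_n)$ and $(y_0,\dots,y_n)$ in $F^{n+1}$, each having entries not all equal, $$\operatorname{Cor}(x_0,\dots,x_n)-\operatorname{Cor}(y_0,\dots,y_n)=\sum_{T=(i_1j_1,\dots,i_nj_n)\in\mathscr{T}(n)}\operatorname{sgn}(T)\,\operatorname{Cor}\left(0,\frac{x_{i_1}-x_{j_1}}{y_{i_1}-y_{j_1}},\dots,\frac{x_{i_n}-x_{j_n}}{y_{i_n}-y_{j_n}}\right),$$ where a summand is omitted if $y_{i_k}=y_{j_k}$ for some $k$. That is, the linear map from the $\mathbf{Q}$-vector space with basis the tuples in $F^{n+1}$ with entries not all equal to $\mathcal{G}_n(F)$, sending a tuple $(x_0,\dots,x_n)$ to $\operatorname{Cor}(x_0,\dots,x_n)$, is surjective, and its kernel is spanned by the elements (left side minus right side) corresponding to the decomposition relations.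
   Context: **Universal symbols.** For distinct $s,s'\in\mathbf{N}$ write $ss'$ for the two-element subset $\{s,s'\}$, regarded as an edge of the complete graph on $\mathbf{N}$. For $n\ge1$ and distinct $s_0,\dots,s_n\in\mathbf{N}$, the universal symbol $\mathrm{S}_n(s_0,\dots,s_n)$ is the element of the tensor algebra over $\mathbf{Q}$ on the set $\binom{\mathbf{N}}{2}$ of two-element subsets defined recursively by $\mathrm{S}_1(s_0,s_1)=s_0s_1$ and, for $n\ge2$, with $s_{n+1}=s_0$, $$\mathrm{S}_n(s_0,\dots,s_n)=\sum_{i=1}^{n}\mathrm{S}_{n-1}(s_0,\dots,\widehat{s_i},\dots,s_n)\otimes s_is_{i+1}-\sum_{i=1}^{n-1}\mathrm{S}_{n-1}(s_0,\dots,\widehat{s_{i+1}},\dots,s_n)\otimes s_is_{i+1}.$$ In the expansion of $\mathrm{S}_n(0,\dots,n)$ each tensor monomial is an ordered $n$-tuple of edges whose underlying edge set is a spanning tree of the complete graph on $\{0,\dots,n\}$, and no ordered monomial occurs more than once. Hence there are a unique subset $\mathscr{T}(n)$ of the set of ordered $n$-tuples of edges of this complete graph and a unique map $\operatorname{sgn}\colon\mathscr{T}(n)\to\{\pm1\}$ with $$\mathrm{S}_n(0,\dots,n)=\sum_{T=(i_1j_1,\dots,i_nj_n)\in\mathscr{T}(n)}\operatorname{sgn}(T)\,(i_1j_1\otimes\cdots\otimes i_nj_n).$$ **The Goncharov Lie coalgebra.** For a field $F$, Kupers–Rudenko–Sierra define $\mathcal{G}(F)=\bigoplus_{n\ge1}\mathcal{G}_n(F)$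 with $\mathcal{G}_n(F)=H^{E_\infty}_{n,2n-1}(B\mathrm{GL}_*(F);\mathbf{Q})$, the rational $E_\infty$-homology (homology of derived $E_\infty$-indecomposables) in bidegree (rank $n$, homological degree $2n-1$) of the $\mathbf{N}$-graded $E_\infty$-algebra $\bigsqcup_n B\mathrm{GL}_n(F)$. It contains distinguished elements (correlators) $\operatorname{Cor}(x_0,\dots,x_n)\in\mathcal{G}_n(F)$ for $x_0,\dots,x_n\in F$ not all equal. The following known theorem of Kupers–Rudenko–Sierra describes $\mathcal{G}_n(F)$ with these elements completely and may be taken as their definition: $\mathcal{G}_n(F)$ is the $\mathbf{Q}$-vector space presented by the generators $\operatorname{Cor}(x_0,\dots,x_n)$ ($x_0,\dots,x_n\in F$ not all equal) and the following four families of relations. 1. Homogeneity: $\operatorname{Cor}(x_0,\dots,x_n)=\operatorname{Cor}(x_0+b,\dots,x_n+b)$ for $b\in F$. 2. Cyclic symmetry: $\operatorname{Cor}(x_0,x_1,\dots,x_n)=\operatorname{Cor}(x_1,x_2,\dots,x_n,x_0)$. 3. Shuffle relations: for $n=p+q$ with $p,q>0$, $\sum_{\sigma\in\operatorname{Sh}(p,q)}\operatorname{Cor}(x_0,x_{\sigma(1)},\dots,x_{\sigma(n)})=0$, where $\operatorname{Sh}(p,q)$ is the set of permutations $\sigma$ of $\{1,\dots,n\}$ such that $(\sigma(1),\dots,\sigma(n))$ is an order-preserving interleaving of $(1,\dots,p)$ and $(p+1,\dots,n)$, i.e. $\sigma^{-1}(1)<\dots<\sigma^{-1}(p)$ and $\sigma^{-1}(p+1)<\dots<\sigma^{-1}(n)$.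 4. Decomposition relations: the relations displayed in the claim. *)

theory Defs
  imports
    Complex_Main
    "HOL-Library.Poly_Mapping"
    "HOL-Combinatorics.Permutations"
begin

section \<open>Free rational vector spaces\<close>

text \<open>The type \<^typ>\<open>'k \<Rightarrow>\<^sub>0 rat\<close> of finitely supported functions is the rational vector space
  with basis \<^typ>\<open>'k\<close>.  The term \<open>Poly_Mapping.single k c\<close> is \<open>c\<close> times the basis vector \<open>k\<close>.\<close>

definition free_scale :: "rat \<Rightarrow> ('k \<Rightarrow>\<^sub>0 rat) \<Rightarrow> ('k \<Rightarrow>\<^sub>0 rat)" where
  "free_scale c v = Poly_Mapping.map ((*) c) v"

lemma lookup_free_scale [simp]:
  "Poly_Mapping.lookup (free_scale c v) k = c * Poly_Mapping.lookup v k"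
  by (simp add: free_scale_def Poly_Mapping.map.rep_eq when_def)

global_interpretation free: vector_space free_scale
  by unfold_locales
    (auto intro!: poly_mapping_eqI simp: lookup_add algebra_simps)

definition free_on :: "'k set \<Rightarrow> ('k \<Rightarrow>\<^sub>0 rat) set" where
  "free_on A = {v. Poly_Mapping.keys v \<subseteq> A}"

lemma free_on_iff: "v \<in> free_on A \<longleftrightarrow> (\<forall>k. k \<notin> A \<longrightarrow> Poly_Mapping.lookup v k = 0)"
  by (auto simp: free_on_def in_keys_iff)

lemma subspace_free_on: "free.subspace (free_on A)"
  by (rule free.subspaceI) (auto simp: free_on_iff lookup_add)

lemma free_on_mono: "A \<subseteq> B \<Longrightarrow> free_on A \<subseteq> free_on B"
  by (auto simp: free_on_def)

lemma single_in_free_on [simp]: "k \<in> A \<Longrightarrow> Poly_Mapping.single k c \<in> free_on A"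
  by (simp add: free_on_def)


section \<open>Universal symbols\<close>

text \<open>The tensor algebra over the rationals on a set of letters has the words in these letters
  as a basis, with the tensor product given by concatenation.  Edges are two-element sets of
  natural numbers.\<close>

definition tensor :: "('e list \<Rightarrow>\<^sub>0 rat) \<Rightarrow> ('e list \<Rightarrow>\<^sub>0 rat) \<Rightarrow> ('e list \<Rightarrow>\<^sub>0 rat)"
  (infixl \<open>\<otimes>\<close> 70) where
  "p \<otimes> q = (\<Sum>u\<in>Poly_Mapping.keys p. \<Sum>v\<in>Poly_Mapping.keys q.
     Poly_Mapping.single (u @ v) (Poly_Mapping.lookup p u * Poly_Mapping.lookup q v))"

definition edge :: "nat \<Rightarrow> nat \<Rightarrow> (nat set list \<Rightarrow>\<^sub>0 rat)" where
  "edge s s' = Poly_Mapping.single [{s, s'}] 1"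

definition omit :: "nat \<Rightarrow> 'a list \<Rightarrow> 'a list" where
  "omit i s = take i s @ drop (Suc i) s"

text \<open>Only \<open>universal_symbol n s\<close> with \<open>n \<ge> 1\<close> and \<open>s\<close> a list of \<open>n + 1\<close> distinct numbers is
  meaningful; the value for \<open>n = 0\<close> is a dummy.  The list \<open>t\<close> realises the convention
  that the entry with index \<open>n + 1\<close> is the one with index \<open>0\<close>.\<close>

fun universal_symbol :: "nat \<Rightarrow> nat list \<Rightarrow> (nat set list \<Rightarrow>\<^sub>0 rat)" where
  "universal_symbol 0 s = 0"
| "universal_symbol (Suc 0) s = edge (s ! 0) (s ! 1)"
| "universal_symbol (Suc (Suc m)) s =
     (let n = Suc (Suc m); t = s @ [s ! 0] in
       (\<Sum>i = 1..n. universal_symbol (Suc m) (omit i s) \<otimes> edge (t ! i) (t ! (i + 1)))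
     - (\<Sum>i = 1..n - 1. universal_symbol (Suc m) (omit (i + 1) s) \<otimes> edge (t ! i) (t ! (i + 1))))"

text \<open>Since no monomial is repeated in the expansion of the universal symbol of \<open>0, \<dots>, n\<close>, the
  set of signed trees is its support, and the signs are its coefficients.\<close>

definition signed_trees :: "nat \<Rightarrow> nat set list set" where
  "signed_trees n = Poly_Mapping.keys (universal_symbol n [0..<n + 1])"

definition tree_sgn :: "nat \<Rightarrow> nat set list \<Rightarrow> rat" where
  "tree_sgn n T = Poly_Mapping.lookup (universal_symbol n [0..<n + 1]) T"


section \<open>The Goncharov Lie coalgebra\<close>

definition tuples :: "nat \<Rightarrow> 'a list set" where
  "tuples n = {xs. length xs = n + 1 \<and> (\<exists>x\<in>set xs. \<exists>y\<in>set xs. x \<noteq> y)}"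

abbreviation gen :: "'a list \<Rightarrow> ('a list \<Rightarrow>\<^sub>0 rat)" where
  "gen xs \<equiv> Poly_Mapping.single xs 1"

definition homogeneity_relations :: "nat \<Rightarrow> ('a::field list \<Rightarrow>\<^sub>0 rat) set" where
  "homogeneity_relations n = {gen xs - gen (map (\<lambda>x. x + b) xs) | xs b. xs \<in> tuples n}"

definition cyclic_relations :: "nat \<Rightarrow> ('a list \<Rightarrow>\<^sub>0 rat) set" where
  "cyclic_relations n = {gen xs - gen (rotate1 xs) | xs. xs \<in> tuples n}"

definition Sh :: "nat \<Rightarrow> nat \<Rightarrow> (nat \<Rightarrow> nat) set" where
  "Sh p q = {\<sigma>. \<sigma> permutes {1..p + q} \<and>
     strict_mono_on {1..p} (inv \<sigma>) \<and> strict_mono_on {p + 1..p + q} (inv \<sigma>)}"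

definition shuffle_relations :: "nat \<Rightarrow> ('a list \<Rightarrow>\<^sub>0 rat) set" where
  "shuffle_relations n =
     {(\<Sum>\<sigma>\<in>Sh p q. gen (xs ! 0 # map (\<lambda>i. xs ! \<sigma> i) [1..<n + 1])) | xs p q.
        xs \<in> tuples n \<and> p > 0 \<and> q > 0 \<and> n = p + q}"

text \<open>The difference of the entries of \<open>xs\<close> at the ends of an edge, which is determined up to
  sign; only quotients of two such differences are used, for which the sign does not matter.\<close>

definition edge_diff :: "'a::field list \<Rightarrow> nat set \<Rightarrow> 'a" where
  "edge_diff xs e = xs ! Min e - xs ! Max e"

definition decomposition_relation ::
    "nat \<Rightarrow> 'a::field list \<Rightarrow> 'a list \<Rightarrow> ('a list \<Rightarrow>\<^sub>0 rat)" where
  "decomposition_relation n xs ys = gen xs - gen ys -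
     (\<Sum>T | T \<in> signed_trees n \<and> (\<forall>e\<in>set T. edge_diff ys e \<noteq> 0).
        free_scale (tree_sgn n T) (gen (0 # map (\<lambda>e. edge_diff xs e / edge_diff ys e) T)))"

definition decomposition_relations :: "nat \<Rightarrow> ('a::field list \<Rightarrow>\<^sub>0 rat) set" where
  "decomposition_relations n =
     {decomposition_relation n xs ys | xs ys. xs \<in> tuples n \<and> ys \<in> tuples n}"

definition correlator_relations :: "nat \<Rightarrow> ('a::field list \<Rightarrow>\<^sub>0 rat) set" where
  "correlator_relations n = homogeneity_relations n \<union> cyclic_relations n \<union>
     shuffle_relations n \<union> decomposition_relations n"

text \<open>The type \<open>'a goncharov\<close> is the direct sum over all weights \<open>n \<ge> 1\<close>: the space with basis all
  tuples with entries not all equal, modulo the relations of all weights.\<close>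

definition goncharov_rel :: "('a::field list \<Rightarrow>\<^sub>0 rat) \<Rightarrow> ('a list \<Rightarrow>\<^sub>0 rat) \<Rightarrow> bool" where
  "goncharov_rel u v \<longleftrightarrow> u \<in> free_on (\<Union>n\<in>{1..}. tuples n) \<and> v \<in> free_on (\<Union>n\<in>{1..}. tuples n) \<and>
     u - v \<in> free.span (\<Union>n\<in>{1..}. correlator_relations n)"

lemma part_equivp_goncharov_rel: "part_equivp (goncharov_rel :: ('a::field list \<Rightarrow>\<^sub>0 rat) \<Rightarrow> _)"
proof (rule part_equivpI)
  let ?R = "goncharov_rel :: ('a list \<Rightarrow>\<^sub>0 rat) \<Rightarrow> _"
  show "\<exists>x. ?R x x"
    by (rule exI[of _ 0]) (simp add: goncharov_rel_def free_on_def free.span_zero)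
  show "symp ?R"
    using free.span_neg by (fastforce simp: goncharov_rel_def symp_def)
  show "transp ?R"
  proof (rule transpI)
    fix u v w :: "'a list \<Rightarrow>\<^sub>0 rat"
    assume "goncharov_rel u v" "goncharov_rel v w"
    then show "goncharov_rel u w"
      using free.span_add[of "u - v" _ "v - w"] by (simp add: goncharov_rel_def)
  qed
qed

lemma goncharov_rel_add:
  "goncharov_rel a b \<Longrightarrow> goncharov_rel c d \<Longrightarrow> goncharov_rel (a + c) (b + d)"
  unfolding goncharov_rel_def
  by (metis (no_types, lifting) add_diff_add free.span_add free.subspace_add subspace_free_on)

lemma goncharov_rel_scale: "goncharov_rel a b \<Longrightarrow> goncharov_rel (free_scale c a) (free_scale c b)"
  unfolding goncharov_rel_def
  by (metis (no_types, lifting) free.scale_right_diff_distrib free.span_scale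
      free.subspace_scale subspace_free_on)

lemma goncharov_rel_uminus: "goncharov_rel a b \<Longrightarrow> goncharov_rel (- a) (- b)"
  using goncharov_rel_scale[of a b "-1"] by simp

lemma goncharov_rel_diff:
  "goncharov_rel a b \<Longrightarrow> goncharov_rel c d \<Longrightarrow> goncharov_rel (a - c) (b - d)"
  using goncharov_rel_add[OF _ goncharov_rel_uminus, of a b c d] by simp

lemma goncharov_rel_zero: "goncharov_rel 0 0"
  by (simp add: goncharov_rel_def free_on_def free.span_zero)

lemma goncharov_rel_same: "goncharov_rel u u \<longleftrightarrow> u \<in> free_on (\<Union>n\<in>{1..}. tuples n)"
  by (auto simp: goncharov_rel_def free.span_zero)

quotient_type (overloaded) 'a goncharov = "'a::field list \<Rightarrow>\<^sub>0 rat" / partial: goncharov_rel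
  by (rule part_equivp_goncharov_rel)

instantiation goncharov :: (field) ab_group_add
begin

lift_definition zero_goncharov :: "'a goncharov" is 0
  by (rule goncharov_rel_zero)

lift_definition plus_goncharov :: "'a goncharov \<Rightarrow> 'a goncharov \<Rightarrow> 'a goncharov" is "(+)"
  by (rule goncharov_rel_add)

lift_definition minus_goncharov :: "'a goncharov \<Rightarrow> 'a goncharov \<Rightarrow> 'a goncharov" is "(-)"
  by (rule goncharov_rel_diff)

lift_definition uminus_goncharov :: "'a goncharov \<Rightarrow> 'a goncharov" is uminus
  by (rule goncharov_rel_uminus)

instance
proof
  fix a b c :: "'a goncharov"
  show "a + b + c = a + (b + c)"
    by transfer (simp add: add.assoc goncharov_rel_add)
  show "a + b = b + a"
    by transfer (simp add: add.commute goncharov_rel_add)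
  show "0 + a = a"
    by transfer simp
  show "- a + a = 0"
    by transfer (simp add: goncharov_rel_zero)
  show "a - b = a + - b"
    by transfer (simp add: goncharov_rel_diff)
qed

end

lift_definition goncharov_scale :: "rat \<Rightarrow> 'a::field goncharov \<Rightarrow> 'a goncharov" is free_scale
  by (rule goncharov_rel_scale)

global_interpretation goncharov: vector_space goncharov_scale
proof
  fix a b :: rat and x y :: "'a goncharov"
  show "goncharov_scale a (x + y) = goncharov_scale a x + goncharov_scale a y"
    by transfer (simp add: free.scale_right_distrib goncharov_rel_add goncharov_rel_scale)
  show "goncharov_scale (a + b) x = goncharov_scale a x + goncharov_scale b x"
    by transfer (simp add: free.scale_left_distrib goncharov_rel_add goncharov_rel_scale)
  show "goncharov_scale a (goncharov_scale b x) = goncharov_scale (a * b) x"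
    by transfer (simp add: goncharov_rel_scale)
  show "goncharov_scale 1 x = x"
    by transfer simp
qed

text \<open>On lists that are not generators, the value of \<open>Cor\<close> is the dummy \<open>0\<close>.\<close>

lift_definition Cor :: "'a::field list \<Rightarrow> 'a goncharov" is
  "\<lambda>xs. if xs \<in> (\<Union>n\<in>{1..}. tuples n) then gen xs else 0"
  by (auto simp: goncharov_rel_def free.span_zero free_on_def)

definition goncharov_weight :: "nat \<Rightarrow> 'a::field goncharov set" where
  "goncharov_weight n = goncharov.span (Cor ` tuples n)"

definition Cor_linear :: "('a::field list \<Rightarrow>\<^sub>0 rat) \<Rightarrow> 'a goncharov" where
  "Cor_linear v = (\<Sum>xs\<in>Poly_Mapping.keys v. goncharov_scale (Poly_Mapping.lookup v xs) (Cor xs))"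

lemma Cor_linear_gen [simp]: "Cor_linear (gen xs) = Cor xs"
  by (simp add: Cor_linear_def)

lemma Cor_linear_eq_sum:
  assumes "finite A" "Poly_Mapping.keys v \<subseteq> A"
  shows "Cor_linear v = (\<Sum>xs\<in>A. goncharov_scale (Poly_Mapping.lookup v xs) (Cor xs))"
  unfolding Cor_linear_def
  by (rule sum.mono_neutral_left) (use assms in \<open>auto simp: in_keys_iff\<close>)

lemma linear_Cor_linear: "Vector_Spaces.linear free_scale goncharov_scale Cor_linear"
proof
  fix u v :: "'a list \<Rightarrow>\<^sub>0 rat" and c :: rat
  let ?A = "Poly_Mapping.keys u \<union> Poly_Mapping.keys v"
  have "Cor_linear (u + v) = (\<Sum>xs\<in>?A. goncharov_scale (Poly_Mapping.lookup (u + v) xs) (Cor xs))"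
    by (rule Cor_linear_eq_sum) (auto dest: set_mp[OF keys_add])
  also have "\<dots> = Cor_linear u + Cor_linear v"
    by (simp add: Cor_linear_eq_sum[of ?A] lookup_add goncharov.scale_left_distrib sum.distrib)
  finally show "Cor_linear (u + v) = Cor_linear u + Cor_linear v" .
  have "Cor_linear (free_scale c u) =
      (\<Sum>xs\<in>Poly_Mapping.keys u. goncharov_scale (Poly_Mapping.lookup (free_scale c u) xs) (Cor xs))"
    by (rule Cor_linear_eq_sum) (auto simp: in_keys_iff)
  then show "Cor_linear (free_scale c u) = goncharov_scale c (Cor_linear u)"
    by (simp add: Cor_linear_def goncharov.scale_sum_right)
qed

lemma abs_goncharov_sum:
  assumes "finite A" "A \<subseteq> (\<Union>n\<in>{1..}. tuples n)"
  shows "abs_goncharov (\<Sum>xs\<in>A. free_scale (c xs) (gen xs)) =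
      (\<Sum>xs\<in>A. goncharov_scale (c xs) (Cor xs :: 'a::field goncharov)) \<and>
    (\<Sum>xs\<in>A. free_scale (c xs) (gen xs)) \<in> free_on (\<Union>n\<in>{1..}. tuples n :: 'a list set)"
  using assms
proof (induction A rule: finite_induct)
  case empty
  then show ?case by (simp add: zero_goncharov_def free_on_def)
next
  case (insert x A)
  let ?B = "\<Union>n\<in>{1..}. tuples n :: 'a list set"
  let ?s = "\<Sum>xs\<in>A. free_scale (c xs) (gen xs)"
  have x: "goncharov_rel (gen x) (gen x)" and s: "goncharov_rel ?s ?s"
    unfolding goncharov_rel_same using insert by (auto intro!: single_in_free_on)
  have "Cor x = abs_goncharov (gen x)"
    using insert.prems by (simp add: Cor.abs_eq)
  then have "goncharov_scale (c x) (Cor x) = abs_goncharov (free_scale (c x) (gen x))"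
    by (simp add: goncharov_scale.abs_eq x)
  moreover have "abs_goncharov (free_scale (c x) (gen x) + ?s) =
      abs_goncharov (free_scale (c x) (gen x)) + abs_goncharov ?s"
    by (rule plus_goncharov.abs_eq[symmetric]) (rule goncharov_rel_scale[OF x], rule s)
  moreover have "free_scale (c x) (gen x) + ?s \<in> free_on ?B"
    using goncharov_rel_add[OF goncharov_rel_scale[OF x] s] by (simp only: goncharov_rel_same)
  ultimately show ?case using insert by simp
qed

lemma free_expansion:
  "v = (\<Sum>xs\<in>Poly_Mapping.keys v. free_scale (Poly_Mapping.lookup v xs) (gen xs))"
  by (rule poly_mapping_eqI)
    (auto simp: lookup_sum lookup_single when_def in_keys_iff if_distrib cong: if_cong)

lemma Cor_linear_eq_0_iff:
  assumes "v \<in> free_on (\<Union>n\<in>{1..}. tuples n)"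
  shows "Cor_linear v = 0 \<longleftrightarrow> v \<in> free.span (\<Union>n\<in>{1..}. correlator_relations n)"
proof -
  have "Cor_linear v = abs_goncharov v"
    using abs_goncharov_sum[of "Poly_Mapping.keys v" "Poly_Mapping.lookup v"] assms
    by (simp add: Cor_linear_def free_on_def flip: free_expansion)
  also have "\<dots> = 0 \<longleftrightarrow> goncharov_rel v 0"
    using assms Quotient3_rel[OF Quotient3_goncharov, of v 0] goncharov_rel_zero
    unfolding zero_goncharov_def goncharov_rel_same[symmetric] by blast
  finally show ?thesis
    using assms by (simp add: goncharov_rel_def) (simp add: free_on_def)
qed

lemma length_universal_symbol: "T \<in> Poly_Mapping.keys (universal_symbol n s) \<Longrightarrow> length T = n"
proof -
  have tensor: "length T = a + b"
    if T: "T \<in> Poly_Mapping.keys (p \<otimes> q)"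
      and a: "\<And>u. u \<in> Poly_Mapping.keys p \<Longrightarrow> length u = a"
      and b: "\<And>u. u \<in> Poly_Mapping.keys q \<Longrightarrow> length u = b"
    for T :: "nat set list" and p q a b
  proof -
    have "Poly_Mapping.lookup (p \<otimes> q) T \<noteq> 0" using T by (simp add: in_keys_iff)
    moreover have "Poly_Mapping.lookup (p \<otimes> q) T = 0"
      if "\<forall>u\<in>Poly_Mapping.keys p. \<forall>v\<in>Poly_Mapping.keys q. u @ v \<noteq> T"
      unfolding tensor_def lookup_sum lookup_single
      using that by (intro sum.neutral ballI) (simp add: when_def)
    ultimately obtain u v where "u \<in> Poly_Mapping.keys p" "v \<in> Poly_Mapping.keys q" "T = u @ v"
      by blast
    then show ?thesis using a b by simp
  qed
  have edge: "length u = 1" if "u \<in> Poly_Mapping.keys (edge i j)" for u i j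
    using that by (simp add: edge_def)
  have "\<forall>T. length T \<noteq> n \<longrightarrow> Poly_Mapping.lookup (universal_symbol n s) T = 0"
  proof (induction n s rule: universal_symbol.induct)
    case (2 s)
    then show ?case using edge by (auto simp: in_keys_iff)
  next
    case (3 m s)
    have "Poly_Mapping.lookup (universal_symbol (Suc m) (omit i s) \<otimes> edge j k) T = 0"
      if "length T \<noteq> Suc (Suc m)" "i \<in> {1..Suc (Suc m)}" for T i j k
    proof (rule ccontr)
      assume "Poly_Mapping.lookup (universal_symbol (Suc m) (omit i s) \<otimes> edge j k) T \<noteq> 0"
      then have "T \<in> Poly_Mapping.keys (universal_symbol (Suc m) (omit i s) \<otimes> edge j k)"
        by (simp add: in_keys_iff)
      moreover have "length u = Suc m"
        if "u \<in> Poly_Mapping.keys (universal_symbol (Suc m) (omit i s))" for u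
        using 3(1)[OF refl refl \<open>i \<in> _\<close>] 3(2) that
        by (cases "i = 1") (auto simp: in_keys_iff)
      ultimately show False
        using tensor[of T _ _ "Suc m" 1] edge that(1) by fastforce
    qed
    then show ?case
      by (simp add: Let_def lookup_minus lookup_add lookup_sum)
  qed simp
  then show "T \<in> Poly_Mapping.keys (universal_symbol n s) \<Longrightarrow> length T = n"
    by (auto simp: in_keys_iff)
qed

lemma correlator_relations_length: "correlator_relations n \<subseteq> free_on {xs. length xs = n + 1}"
proof -
  note [simp] = tuples_def free.subspace_diff[OF subspace_free_on]
  have "homogeneity_relations n \<subseteq> free_on {xs. length xs = n + 1}"
    "cyclic_relations n \<subseteq> free_on {xs. length xs = n + 1}"
    by (auto simp: homogeneity_relations_def cyclic_relations_def)
  moreover have "shuffle_relations n \<subseteq> free_on {xs. length xs = n + 1}"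
    by (auto simp: shuffle_relations_def intro!: free.subspace_sum[OF subspace_free_on])
  moreover have "decomposition_relations n \<subseteq> free_on {xs. length xs = n + 1}"
    by (auto simp: decomposition_relations_def decomposition_relation_def signed_trees_def
        length_universal_symbol intro!: free.subspace_diff[OF subspace_free_on]
        free.subspace_sum[OF subspace_free_on] free.subspace_scale[OF subspace_free_on])
  ultimately show ?thesis by (simp add: correlator_relations_def)
qed

text \<open>The weight \<open>n\<close> part is presented by the generators and the relations of weight \<open>n\<close>.\<close>

lemma goncharov_weight_presentation:
  assumes "n \<ge> 1"
  shows "Cor_linear ` free_on (tuples n) = (goncharov_weight n :: 'a::field goncharov set)"
    and "v \<in> free_on (tuples n) \<Longrightarrow>
      Cor_linear v = (0 :: 'a goncharov) \<longleftrightarrow> v \<in> free.span (correlator_relations n)"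
proof -
  have eq: "free_on (tuples n) = free.span (gen ` tuples n :: ('a list \<Rightarrow>\<^sub>0 rat) set)"
  proof
    show "free_on (tuples n) \<subseteq> free.span (gen ` tuples n :: ('a list \<Rightarrow>\<^sub>0 rat) set)"
    proof
      fix v :: "'a list \<Rightarrow>\<^sub>0 rat" assume "v \<in> free_on (tuples n)"
      then show "v \<in> free.span (gen ` tuples n)"
        by (subst free_expansion, intro free.span_sum free.span_scale free.span_base)
          (auto simp: free_on_def)
    qed
    show "free.span (gen ` tuples n :: ('a list \<Rightarrow>\<^sub>0 rat) set) \<subseteq> free_on (tuples n)"
      by (rule free.span_minimal) (auto simp: subspace_free_on)
  qed
  interpret Vector_Spaces.linear free_scale goncharov_scale
      "Cor_linear :: ('a list \<Rightarrow>\<^sub>0 rat) \<Rightarrow> 'a goncharov"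
    by (rule linear_Cor_linear)
  show "Cor_linear ` free_on (tuples n) = (goncharov_weight n :: 'a goncharov set)"
    unfolding eq span_image[symmetric] by (simp add: goncharov_weight_def image_image)
next
  let ?S = "free.span (correlator_relations n :: ('a list \<Rightarrow>\<^sub>0 rat) set)"
  let ?P = "\<lambda>v w. \<forall>k. length k = n + 1 \<longrightarrow> Poly_Mapping.lookup v k = Poly_Mapping.lookup w k"
  assume v: "v \<in> free_on (tuples n)"
  have S: "?S \<subseteq> free_on {xs. length xs = n + 1}"
    by (intro free.span_minimal correlator_relations_length subspace_free_on)
  have sub: "free.subspace {v. \<exists>w\<in>?S. ?P v w}"
  proof (rule free.subspaceI)
    show "0 \<in> {v. \<exists>w\<in>?S. ?P v w}"
      using free.span_zero by fastforce
    show "u + u' \<in> {v. \<exists>w\<in>?S. ?P v w}"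
      if "u \<in> {v. \<exists>w\<in>?S. ?P v w}" "u' \<in> {v. \<exists>w\<in>?S. ?P v w}" for u u'
    proof -
      from that obtain w w' where "w \<in> ?S" "w' \<in> ?S" "?P u w" "?P u' w'" by blast
      then show ?thesis by (auto simp: lookup_add intro!: bexI[of _ "w + w'"] free.span_add)
    qed
    show "free_scale c u \<in> {v. \<exists>w\<in>?S. ?P v w}"
      if "u \<in> {v. \<exists>w\<in>?S. ?P v w}" for u c
    proof -
      from that obtain w where "w \<in> ?S" "?P u w" by blast
      then show ?thesis by (auto intro!: bexI[of _ "free_scale c w"] free.span_scale)
    qed
  qed
  have base: "\<exists>w\<in>?S. ?P u w" if "u \<in> correlator_relations m" for u :: "'a list \<Rightarrow>\<^sub>0 rat" and m
  proof (cases "m = n")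
    case True
    then show ?thesis using that by (blast intro: free.span_base)
  next
    case False
    then have "?P u 0"
      using that correlator_relations_length[of m] by (auto simp: free_on_iff)
    then show ?thesis using free.span_zero by blast
  qed
  have *: "free.span (\<Union>n\<in>{1..}. correlator_relations n) \<subseteq> {v. \<exists>w\<in>?S. ?P v w}"
    by (rule free.span_minimal[OF _ sub]) (use base in auto)
  have "v \<in> ?S" if "v \<in> free.span (\<Union>n\<in>{1..}. correlator_relations n)"
  proof -
    from that * obtain w where w: "w \<in> ?S" "?P v w" by blast
    have "Poly_Mapping.lookup v k = Poly_Mapping.lookup w k" for k
      using w v S by (cases "length k = n + 1") (auto simp: free_on_iff tuples_def)
    then show ?thesis using w by (metis poly_mapping_eqI)
  qed
  moreover have "?S \<subseteq> free.span (\<Union>n\<in>{1..}. correlator_relations n)"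
    by (rule free.span_mono) (use assms in auto)
  moreover have "v \<in> free_on (\<Union>n\<in>{1..}. tuples n)"
    using v assms by (auto simp: free_on_def)
  ultimately show "Cor_linear v = (0 :: 'a goncharov) \<longleftrightarrow> v \<in> ?S"
    using Cor_linear_eq_0_iff by blast
qed

end

theory Submission
  imports Defs
begin

text \<open>
  The presentation of the weight \<open>n\<close> part by all four families of relations is known, so the point
  is that homogeneity, cyclic symmetry and the shuffle relations follow from the decomposition
  relations.  A vector lies in a span as soon as every linear functional that vanishes on the
  spanning set vanishes on it (\<open>in_span_if_functionals_vanish\<close>), so it suffices to study rational
  valued functions \<open>c\<close> of tuples that satisfy the decomposition relations
  (locale \<open>decomposition_functional\<close>).

  The idea is to choose \<open>y\<close> with a single nonzero entry, in position \<open>k\<close>.  The only trees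
  without a vanishing denominator are then the stars centred at \<open>k\<close>, and the ratios become
  differences \<open>x\<^sub>i - x\<^sub>k\<close>.  Write a star at \<open>t\<close> as the word of its leaves, in the order of its edges.  In
  the universal symbol of \<open>(t, v)\<close> the stars at \<open>t\<close> contribute the single word \<open>v\<close>
  (\<open>pairing_star_first\<close>), and in that of \<open>(a, u, t, v)\<close> they contribute \<open>(-1)\<^sup>|\<^sup>v\<^sup>|\<close> times \<open>a\<close> followed by the
  shuffle product of \<open>u\<close> and the reversal of \<open>v\<close> (\<open>pairing_star_later\<close>).

  \<^item> The case \<open>k = 0\<close> reads \<open>c(x) = c(x - x\<^sub>0)\<close> up to a constant, which is seen to be zero by taking
    special values of \<open>x\<close>.  This gives homogeneity.
  \<^item> The case \<open>k = n\<close> says that a rotation changes \<open>c\<close> by a constant.  As \<open>n + 1\<close> rotations are the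
    identity, the constant is zero.  This gives cyclic symmetry.
  \<^item> The remaining cases, combined with cyclic symmetry, become the reflection formula
    \<open>c(t, v, a, u) = (-1)\<^sup>|\<^sup>v\<^sup>| \<Sum> c(t, a, w)\<close>, where \<open>w\<close> runs over the shuffles of \<open>u\<close> and the reversal
    of \<open>v\<close>.  A shuffle sum splits into two parts according to the first letter.  The reflection
    formula turns both parts into the same value of \<open>c\<close>, with opposite signs, so the sum vanishes
    (lemma \<open>shuffle\<close>).

  Finally, the decomposition relations only involve generators, that is, tuples with entries not all
  equal, because the trees occurring in the universal symbol are connected
  (\<open>universal_symbol_connected\<close>).
\<close>

section \<open>Linear functionals on free vector spaces\<close>

text \<open>The value at \<open>p\<close> of the linear functional that extends \<open>g\<close>.  With it, a sum over the signed trees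
  can be computed from the recursion of the universal symbol, without describing which trees occur.\<close>

definition pairing :: "('k \<Rightarrow> rat) \<Rightarrow> ('k \<Rightarrow>\<^sub>0 rat) \<Rightarrow> rat" where
  "pairing g p = (\<Sum>T\<in>Poly_Mapping.keys p. Poly_Mapping.lookup p T * g T)"

lemma pairing_superset:
  assumes "finite A" "Poly_Mapping.keys p \<subseteq> A"
  shows "pairing g p = (\<Sum>T\<in>A. Poly_Mapping.lookup p T * g T)"
  unfolding pairing_def
  by (rule sum.mono_neutral_left) (use assms in \<open>auto simp: in_keys_iff\<close>)

lemma pairing_zero [simp]: "pairing g 0 = 0"
  by (simp add: pairing_def)

lemma pairing_single [simp]: "pairing g (Poly_Mapping.single T r) = r * g T"
  by (simp add: pairing_def)

lemma pairing_add: "pairing g (p + q) = pairing g p + pairing g q"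
proof -
  let ?A = "Poly_Mapping.keys p \<union> Poly_Mapping.keys q"
  have "pairing g (p + q) = (\<Sum>T\<in>?A. Poly_Mapping.lookup (p + q) T * g T)"
    by (rule pairing_superset) (auto dest: set_mp[OF keys_add])
  then show ?thesis
    by (simp add: pairing_superset[of ?A] lookup_add distrib_right sum.distrib)
qed

lemma pairing_diff: "pairing g (p - q) = pairing g p - pairing g q"
  using pairing_add[of g "p - q" q] by simp

lemma pairing_sum: "pairing g (\<Sum>i\<in>A. h i) = (\<Sum>i\<in>A. pairing g (h i))"
  by (induction A rule: infinite_finite_induct) (auto simp: pairing_add)

lemma pairing_eq_0: "(\<And>T. T \<in> Poly_Mapping.keys p \<Longrightarrow> g T = 0) \<Longrightarrow> pairing g p = 0"
  by (simp add: pairing_def)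

lemma tensor_edge:
  "p \<otimes> edge a b =
    (\<Sum>u\<in>Poly_Mapping.keys p. Poly_Mapping.single (u @ [{a, b}]) (Poly_Mapping.lookup p u))"
  by (simp add: tensor_def edge_def)

lemma pairing_tensor_edge: "pairing g (p \<otimes> edge a b) = pairing (\<lambda>T. g (T @ [{a, b}])) p"
  by (simp add: tensor_edge pairing_sum pairing_def[of _ p])

text \<open>Otherwise \<open>v\<close> could be added to a basis of the span of \<open>D\<close>, and there would be a functional with
  value \<open>1\<close> at \<open>v\<close> and \<open>0\<close> on that basis.\<close>

lemma in_span_if_functionals_vanish:
  fixes v :: "'k \<Rightarrow>\<^sub>0 rat"
  assumes "\<And>\<phi>. Vector_Spaces.linear free_scale (*) \<phi> \<Longrightarrow> (\<And>d. d \<in> D \<Longrightarrow> \<phi> d = 0) \<Longrightarrow> \<phi> v = 0"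
  shows "v \<in> free.span D"
proof (rule ccontr)
  assume v: "v \<notin> free.span D"
  interpret rat: vector_space "(*) :: rat \<Rightarrow> rat \<Rightarrow> rat"
    by unfold_locales (auto simp: algebra_simps)
  interpret free_rat: vector_space_pair "free_scale :: rat \<Rightarrow> ('k \<Rightarrow>\<^sub>0 rat) \<Rightarrow> _" "(*)" ..
  obtain B where B: "B \<subseteq> D" "free.independent B" "D \<subseteq> free.span B"
    by (rule free.maximal_independent_subset)
  have "v \<notin> free.span B"
    using v free.span_mono[OF B(1)] by blast
  then have "free.independent (insert v B)"
    using B(2) by (rule free.independent_insertI)
  then have "\<exists>\<phi>. Vector_Spaces.linear free_scale (*) \<phi> \<and>
      (\<forall>x\<in>insert v B. \<phi> x = (if x = v then 1 else 0 :: rat))"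
    by (rule free_rat.linear_independent_extend)
  then obtain \<phi> where \<phi>: "Vector_Spaces.linear free_scale (*) \<phi>"
    "\<forall>x\<in>insert v B. \<phi> x = (if x = v then 1 else 0)"
    by blast
  interpret \<phi>: Vector_Spaces.linear free_scale "(*)" \<phi> by (rule \<phi>(1))
  have "\<phi> b = 0" if "b \<in> B" for b
    using \<phi>(2) that free.span_base[OF that] \<open>v \<notin> free.span B\<close> by auto
  then have "\<phi> d = 0" if "d \<in> D" for d
    using \<phi>.eq_0_on_span[of B d] B(3) that by blast
  then have "\<phi> v = 0" using assms \<phi>(1) by blast
  then show False using \<phi>(2) by simp
qed

section \<open>Shuffles of lists\<close>

text \<open>The sum over all shuffles with multiplicity, so that letters may be repeated; this makes
  \<open>shuffle_sum_map\<close> true for maps that are not injective.\<close>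

fun shuffle_sum :: "('a list \<Rightarrow> rat) \<Rightarrow> 'a list \<Rightarrow> 'a list \<Rightarrow> rat" where
  "shuffle_sum f [] v = f v"
| "shuffle_sum f u [] = f u"
| "shuffle_sum f (a # u) (b # v) =
    shuffle_sum (\<lambda>w. f (a # w)) u (b # v) + shuffle_sum (\<lambda>w. f (b # w)) (a # u) v"

lemma shuffle_sum_Nil2 [simp]: "shuffle_sum f u [] = f u"
  by (cases u) auto

text \<open>The recursion of the universal symbol appends edges at the end, so the shuffles have to be split
  by the last letter as well.\<close>

lemma shuffle_sum_snoc:
  "shuffle_sum f (u @ [a]) (v @ [b]) =
    shuffle_sum (\<lambda>w. f (w @ [a])) u (v @ [b]) + shuffle_sum (\<lambda>w. f (w @ [b])) (u @ [a]) v"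
proof (induction f u v rule: shuffle_sum.induct)
  case (1 f v)
  show ?case
  proof (induction v arbitrary: f)
    case Nil
    show ?case by simp
  next
    case (Cons c v)
    show ?case using Cons[of "\<lambda>w. f (c # w)"] by simp
  qed
next
  case (2 f c u)
  show ?case
  proof (induction "c # u" arbitrary: f c u)
    case (Cons c u)
    show ?case
    proof (cases u)
      case Nil
      then show ?thesis by simp
    next
      case (Cons d u')
      then show ?thesis using Cons.hyps[of d u' "\<lambda>w. f (c # w)"] by simp
    qed
  qed
next
  case (3 f c u d v)
  then show ?case by simp
qed

lemma shuffle_sum_map: "shuffle_sum f (map h u) (map h v) = shuffle_sum (\<lambda>w. f (map h w)) u v"
  by (induction "\<lambda>w. f (map h w)" u v arbitrary: f rule: shuffle_sum.induct) auto

lemma shuffle_sum_cong: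
  "(\<And>w. set w = set u \<union> set v \<Longrightarrow> length w = length u + length v \<Longrightarrow> f w = g w) \<Longrightarrow>
    shuffle_sum f u v = shuffle_sum g u v"
proof (induction f u v arbitrary: g rule: shuffle_sum.induct)
  case (3 f a u b v)
  show ?case
    by (simp, intro arg_cong2[where f = "(+)"] 3(1,2) 3(3)) auto
qed auto

lemma shuffle_sum_conv_sum:
  "set u \<inter> set v = {} \<Longrightarrow> shuffle_sum f u v = (\<Sum>w\<in>shuffles u v. f w)"
proof (induction f u v rule: shuffle_sum.induct)
  case (3 f a u b v)
  have "(\<Sum>w\<in>shuffles (a # u) (b # v). f w) =
      (\<Sum>w\<in>(#) a ` shuffles u (b # v). f w) + (\<Sum>w\<in>(#) b ` shuffles (a # u) v. f w)"
    using 3(3) by (subst shuffles.simps, subst sum.union_disjoint) auto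
  then show ?case using 3 by (simp add: sum.reindex)
qed auto

lemma in_shuffles_iff:
  assumes "set us \<inter> set vs = {}"
  shows "w \<in> shuffles us vs \<longleftrightarrow>
    filter (\<lambda>x. x \<in> set us) w = us \<and> filter (\<lambda>x. x \<notin> set us) w = vs"
  using assms filter_shuffles_disjoint1[OF assms] partition_in_shuffles[of w "\<lambda>x. x \<in> set us"]
  by metis

lemma sorted_wrt_iff_on_set:
  "sorted_wrt (<) (l :: nat list) \<Longrightarrow>
    sorted_wrt R l \<longleftrightarrow> (\<forall>i\<in>set l. \<forall>j\<in>set l. i < j \<longrightarrow> R i j)"
proof (induction l)
  case (Cons a l)
  then show ?case by (auto dest: order.strict_trans)
qed simp

text \<open>The word \<open>\<sigma>(1), \<dots>, \<sigma>(n)\<close> has the letter \<open>a\<close> in position \<open>\<sigma>\<inverse>(a)\<close>, so the letters from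
  \<open>A\<close> appear in increasing order exactly if their positions increase.\<close>

lemma sorted_filter_iff_inv_mono:
  assumes "\<sigma> permutes {1..n}" "A \<subseteq> {1..n}"
  shows "sorted_wrt (<) (filter (\<lambda>x. x \<in> A) (map \<sigma> [1..<n + 1])) \<longleftrightarrow>
    strict_mono_on A (inv \<sigma>)"
proof -
  let ?l = "filter (\<lambda>i. \<sigma> i \<in> A) [1..<n + 1]"
  have inv: "inv \<sigma> (\<sigma> i) = i" "\<sigma> (inv \<sigma> i) = i" for i
    using permutes_inverses[OF assms(1)] by auto
  have set: "set ?l = inv \<sigma> ` A"
  proof -
    have "i \<in> {1..n}" if "\<sigma> i \<in> A" for i
      using that assms permutes_in_image[OF assms(1), of i] by auto
    then have "i \<in> set ?l \<longleftrightarrow> \<sigma> i \<in> A" for i by fastforce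
    moreover have "i \<in> inv \<sigma> ` A \<longleftrightarrow> \<sigma> i \<in> A" for i using inv by (metis imageE imageI)
    ultimately show ?thesis by blast
  qed
  have "sorted_wrt (<) (filter (\<lambda>x. x \<in> A) (map \<sigma> [1..<n + 1])) \<longleftrightarrow>
      sorted_wrt (\<lambda>i j. \<sigma> i < \<sigma> j) ?l"
    by (simp add: filter_map sorted_wrt_map comp_def)
  also have "\<dots> \<longleftrightarrow> (\<forall>i\<in>inv \<sigma> ` A. \<forall>j\<in>inv \<sigma> ` A. i < j \<longrightarrow> \<sigma> i < \<sigma> j)"
    unfolding set[symmetric]
    by (rule sorted_wrt_iff_on_set) (simp add: sorted_wrt_filter del: upt_Suc)
  also have "\<dots> \<longleftrightarrow> (\<forall>a\<in>A. \<forall>b\<in>A. inv \<sigma> a < inv \<sigma> b \<longrightarrow> a < b)"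
    by (simp add: inv)
  also have "\<dots> \<longleftrightarrow> strict_mono_on A (inv \<sigma>)"
  proof
    assume mono: "\<forall>a\<in>A. \<forall>b\<in>A. inv \<sigma> a < inv \<sigma> b \<longrightarrow> a < b"
    show "strict_mono_on A (inv \<sigma>)"
    proof (rule strict_mono_onI)
      fix a b assume ab: "a \<in> A" "b \<in> A" "a < b"
      then have "inv \<sigma> a \<noteq> inv \<sigma> b" using inv(2)[of a] inv(2)[of b] by auto
      moreover have "\<not> inv \<sigma> b < inv \<sigma> a" using mono ab by force
      ultimately show "inv \<sigma> a < inv \<sigma> b" by simp
    qed
  next
    assume mono: "strict_mono_on A (inv \<sigma>)"
    show "\<forall>a\<in>A. \<forall>b\<in>A. inv \<sigma> a < inv \<sigma> b \<longrightarrow> a < b"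
    proof (intro ballI impI)
      fix a b assume ab: "a \<in> A" "b \<in> A" "inv \<sigma> a < inv \<sigma> b"
      then have "\<not> b < a" using strict_mono_onD[OF mono, of b a] by auto
      moreover have "a \<noteq> b" using ab(3) by auto
      ultimately show "a < b" by simp
    qed
  qed
  finally show ?thesis .
qed

lemma bij_betw_Sh_shuffles:
  "bij_betw (\<lambda>\<sigma>. map \<sigma> [1..<p + q + 1]) (Sh p q) (shuffles [1..<p + 1] [p + 1..<p + q + 1])"
proof -
  let ?n = "p + q" and ?us = "[1..<p + 1]" and ?vs = "[p + 1..<p + q + 1]"
  let ?h = "\<lambda>\<sigma>. map \<sigma> [1..<?n + 1] :: nat list"
  have disj: "set ?us \<inter> set ?vs = {}" by auto
  have sorted: "sorted_wrt (<) ?us" "sorted_wrt (<) ?vs" "set ?us \<subseteq> {1..?n}" "set ?vs \<subseteq> {1..?n}"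
    by (simp_all del: upt_Suc) auto
  have Sh_iff: "\<sigma> \<in> Sh p q \<longleftrightarrow> ?h \<sigma> \<in> shuffles ?us ?vs" if \<sigma>: "\<sigma> permutes {1..?n}" for \<sigma>
  proof -
    have set: "set (?h \<sigma>) = {1..?n}" and dist: "distinct (?h \<sigma>)"
      using permutes_image[OF \<sigma>] permutes_inj_on[OF \<sigma>]
      by (auto simp: distinct_map atLeastLessThanSuc_atLeastAtMost simp del: upt_Suc)
    have eq: "filter (\<lambda>x. x \<in> set l) (?h \<sigma>) = l \<longleftrightarrow> strict_mono_on (set l) (inv \<sigma>)"
      if l: "sorted_wrt (<) l" "set l \<subseteq> {1..?n}" for l
    proof -
      have "filter (\<lambda>x. x \<in> set l) (?h \<sigma>) = l \<longleftrightarrow>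
          sorted_wrt (<) (filter (\<lambda>x. x \<in> set l) (?h \<sigma>))"
      proof
        assume "sorted_wrt (<) (filter (\<lambda>x. x \<in> set l) (?h \<sigma>))"
        moreover have "set (filter (\<lambda>x. x \<in> set l) (?h \<sigma>)) = set l"
          using set l(2) by auto
        ultimately show "filter (\<lambda>x. x \<in> set l) (?h \<sigma>) = l"
          by (intro strict_sorted_equal) (simp_all only: l(1))
      qed (simp add: l(1))
      then show ?thesis using sorted_filter_iff_inv_mono[OF \<sigma> l(2)] by simp
    qed
    have "filter (\<lambda>x. x \<notin> set ?us) (?h \<sigma>) = filter (\<lambda>x. x \<in> set ?vs) (?h \<sigma>)"
      by (rule filter_cong[OF refl]) (use set in auto)
    then have "?h \<sigma> \<in> shuffles ?us ?vs \<longleftrightarrow>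
        strict_mono_on (set ?us) (inv \<sigma>) \<and> strict_mono_on (set ?vs) (inv \<sigma>)"
      unfolding in_shuffles_iff[OF disj] using eq[of ?us] eq[of ?vs] sorted
      by (simp del: upt_Suc)
    also have "set ?us = {1..p}" by auto
    also have "set ?vs = {p + 1..p + q}" by auto
    finally show ?thesis using \<sigma> by (simp add: Sh_def)
  qed
  show ?thesis
  proof (rule bij_betw_imageI)
    show "inj_on ?h (Sh p q)"
    proof (rule inj_onI)
      fix \<sigma> \<tau> assume *: "\<sigma> \<in> Sh p q" "\<tau> \<in> Sh p q" "?h \<sigma> = ?h \<tau>"
      then have \<sigma>: "\<sigma> permutes {1..?n}" and \<tau>: "\<tau> permutes {1..?n}" by (auto simp: Sh_def)
      show "\<sigma> = \<tau>"
      proof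
        fix i
        show "\<sigma> i = \<tau> i"
        proof (cases "i \<in> {1..?n}")
          case True
          then have "i \<in> set [1..<?n + 1]" by auto
          then show ?thesis using *(3)[unfolded map_eq_conv] by blast
        next
          case False
          then show ?thesis
            using permutes_not_in[OF \<sigma> False] permutes_not_in[OF \<tau> False] by simp
        qed
      qed
    qed
    show "?h ` Sh p q = shuffles ?us ?vs"
    proof
      have "\<sigma> permutes {1..?n}" if "\<sigma> \<in> Sh p q" for \<sigma>
        using that by (simp add: Sh_def)
      then show "?h ` Sh p q \<subseteq> shuffles ?us ?vs"
        by (intro image_subsetI) (simp only: Sh_iff[symmetric])
      show "shuffles ?us ?vs \<subseteq> ?h ` Sh p q"
      proof
        fix w assume w: "w \<in> shuffles ?us ?vs"
        have len: "length w = ?n" using length_shuffles[OF w] by simp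
        have "set ?us \<union> set ?vs = {1..?n}" by auto
        then have set: "set w = {1..?n}" using set_shuffles[OF w] by simp
        have dist: "distinct w" by (rule distinct_disjoint_shuffles[OF _ _ disj w]) simp_all
        define \<sigma> where "\<sigma> i = (if i \<in> {1..?n} then w ! (i - 1) else i)" for i
        have map: "?h \<sigma> = w"
          using len by (intro nth_equalityI) (auto simp: \<sigma>_def simp del: upt_Suc)
        have "\<sigma> ` {1..?n} = {1..?n}"
          using arg_cong[OF map, of set] set
          by (simp add: atLeastLessThanSuc_atLeastAtMost del: upt_Suc)
        moreover have "inj_on \<sigma> {1..?n}"
          using dist unfolding map[symmetric] distinct_map
          by (simp add: atLeastLessThanSuc_atLeastAtMost del: upt_Suc)
        ultimately have "\<sigma> permutes {1..?n}"
          by (intro bij_imp_permutes) (simp_all only: bij_betw_def \<sigma>_def if_False simp_thms)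
        then have "\<sigma> \<in> Sh p q" using w by (simp only: Sh_iff map)
        then show "w \<in> ?h ` Sh p q" by (rule image_eqI[rotated]) (rule map[symmetric])
      qed
    qed
  qed
qed

lemma sum_Sh_eq_shuffle_sum:
  "(\<Sum>\<sigma>\<in>Sh p q. f (map \<sigma> [1..<p + q + 1])) = shuffle_sum f [1..<p + 1] [p + 1..<p + q + 1]"
  using sum.reindex_bij_betw[OF bij_betw_Sh_shuffles, of f p q]
  by (subst shuffle_sum_conv_sum) (auto simp del: upt_Suc)

section \<open>Trees in the universal symbol\<close>

lemma omit_append_Cons [simp]: "omit (length l) (l @ x # r) = l @ r"
  by (simp add: omit_def)

lemma length_omit: "i < length s \<Longrightarrow> length (omit i s) = length s - 1"
  by (simp add: omit_def)

lemma set_omit_subset: "set (omit i s) \<subseteq> set s"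
  by (auto simp: omit_def dest: in_set_takeD in_set_dropD)

lemma nth_in_set_omit:
  assumes "j < length s" "j \<noteq> i"
  shows "s ! j \<in> set (omit i s)"
proof (cases "j < i")
  case True
  then show ?thesis using assms by (auto simp: omit_def in_set_conv_nth intro!: exI[of _ j])
next
  case False
  then have "drop (Suc i) s ! (j - Suc i) = s ! j" "j - Suc i < length (drop (Suc i) s)"
    using assms by auto
  then show ?thesis by (metis omit_def nth_mem Un_iff set_append)
qed

lemma pairing_universal_symbol:
  "pairing g (universal_symbol (Suc (Suc m)) s) =
    (\<Sum>i = 1..Suc (Suc m). pairing
      (\<lambda>T. g (T @ [{(s @ [s ! 0]) ! i, (s @ [s ! 0]) ! (i + 1)}]))
      (universal_symbol (Suc m) (omit i s))) -
    (\<Sum>i = 1..Suc m. pairing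
      (\<lambda>T. g (T @ [{(s @ [s ! 0]) ! i, (s @ [s ! 0]) ! (i + 1)}]))
      (universal_symbol (Suc m) (omit (i + 1) s)))"
  unfolding universal_symbol.simps Let_def pairing_diff pairing_sum pairing_tensor_edge by simp

lemma lookup_eq_pairing: "Poly_Mapping.lookup p T = pairing (\<lambda>U. if U = T then 1 else 0) p"
  by (simp add: pairing_def if_distrib sum.delta in_keys_iff cong: if_cong)

lemma universal_symbol_keysE:
  assumes "T \<in> Poly_Mapping.keys (universal_symbol (Suc (Suc m)) s)"
  obtains i j T' where "i \<in> {1..Suc (Suc m)}" "j = i \<or> j = i + 1 \<and> i \<le> Suc m"
    "T' \<in> Poly_Mapping.keys (universal_symbol (Suc m) (omit j s))"
    "T = T' @ [{(s @ [s ! 0]) ! i, (s @ [s ! 0]) ! (i + 1)}]"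
proof (rule ccontr)
  assume "\<not> thesis"
  note none = that \<open>\<not> thesis\<close>
  have "pairing (\<lambda>U. if U = T then 1 else 0) (universal_symbol (Suc (Suc m)) s) = 0"
    unfolding pairing_universal_symbol
  proof (intro diff_eq_eq[THEN iffD2], simp only: add_0, subst (1 2) sum.neutral)
    show "\<forall>i\<in>{1..Suc (Suc m)}. pairing
      (\<lambda>U. if U @ [{(s @ [s ! 0]) ! i, (s @ [s ! 0]) ! (i + 1)}] = T then 1 else 0)
      (universal_symbol (Suc m) (omit i s)) = 0"
      using none by (intro ballI pairing_eq_0) auto
    show "\<forall>i\<in>{1..Suc m}. pairing
      (\<lambda>U. if U @ [{(s @ [s ! 0]) ! i, (s @ [s ! 0]) ! (i + 1)}] = T then 1 else 0)
      (universal_symbol (Suc m) (omit (i + 1) s)) = 0"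
    proof (intro ballI pairing_eq_0)
      fix i U assume "i \<in> {1..Suc m}" "U \<in> Poly_Mapping.keys (universal_symbol (Suc m) (omit (i + 1) s))"
      then show "(if U @ [{(s @ [s ! 0]) ! i, (s @ [s ! 0]) ! (i + 1)}] = T then 1 else 0) = (0 :: rat)"
        using none(1)[of i "i + 1" U] none(2) by auto
    qed
  qed simp
  then show False using assms by (simp add: lookup_eq_pairing[symmetric] in_keys_iff)
qed

lemma universal_symbol_edge_subset:
  "T \<in> Poly_Mapping.keys (universal_symbol n s) \<Longrightarrow> length s = n + 1 \<Longrightarrow> e \<in> set T \<Longrightarrow>
    e \<noteq> {} \<and> e \<subseteq> set s"
proof (induction n arbitrary: s T)
  case (Suc m')
  show ?case
  proof (cases m')
    case 0
    then show ?thesis using Suc.prems by (auto simp: edge_def)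
  next
    case (Suc m)
    obtain i j T' where *: "i \<in> {1..Suc (Suc m)}" "j = i \<or> j = i + 1 \<and> i \<le> Suc m"
      "T' \<in> Poly_Mapping.keys (universal_symbol (Suc m) (omit j s))"
      "T = T' @ [{(s @ [s ! 0]) ! i, (s @ [s ! 0]) ! (i + 1)}]"
      by (rule universal_symbol_keysE[OF Suc.prems(1)[unfolded Suc]])
    have "length (omit j s) = m' + 1"
      using *(1,2) Suc Suc.prems(2) by (subst length_omit) auto
    then have "e \<noteq> {} \<and> e \<subseteq> set s" if "e \<in> set T'"
      using Suc.IH[of T' "omit j s"] *(3) that set_omit_subset[of j s] Suc by blast
    moreover have "(s @ [s ! 0]) ! i \<in> set s" if "i \<le> Suc (Suc (Suc m))" for i
      using that Suc Suc.prems(2) by (auto simp: nth_append)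
    ultimately show ?thesis using * Suc.prems(3) by auto
  qed
qed simp

text \<open>Every step of the recursion joins the vertex that was omitted to one of the other vertices.  A
  function \<open>f\<close> that agrees at the ends of every edge is therefore constant.\<close>

lemma universal_symbol_connected:
  "T \<in> Poly_Mapping.keys (universal_symbol n s) \<Longrightarrow> length s = n + 1 \<Longrightarrow>
    (\<And>x y. {x, y} \<in> set T \<Longrightarrow> f x = f y) \<Longrightarrow> x \<in> set s \<Longrightarrow> y \<in> set s \<Longrightarrow> f x = f y"
proof (induction n arbitrary: s T x y)
  case (Suc m')
  show ?case
  proof (cases m')
    case 0
    then obtain a b where s: "s = [a, b]"
      using Suc.prems(2) by (auto simp: length_Suc_conv)
    then have "T = [{a, b}]" using Suc.prems(1) 0 by (simp add: edge_def)
    then have "f a = f b" using Suc.prems(3)[of a b] by simp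
    then show ?thesis using Suc.prems(4,5) s by auto
  next
    case (Suc m)
    obtain i j T' where *: "i \<in> {1..Suc (Suc m)}" "j = i \<or> j = i + 1 \<and> i \<le> Suc m"
      "T' \<in> Poly_Mapping.keys (universal_symbol (Suc m) (omit j s))"
      "T = T' @ [{(s @ [s ! 0]) ! i, (s @ [s ! 0]) ! (i + 1)}]"
      by (rule universal_symbol_keysE[OF Suc.prems(1)[unfolded Suc]])
    have len: "length s = Suc (Suc (Suc m))" and j: "j < length s"
      using *(1,2) Suc Suc.prems(2) by auto
    \<comment> \<open>The new edge joins the omitted vertex, with index \<open>j\<close>, to the one with index \<open>r\<close>; the
      latter is \<open>0\<close> if the edge is the one that closes the cycle.\<close>
    obtain r where r: "r < length s" "r \<noteq> j" "{s ! j, s ! r} \<in> set T"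
    proof (cases "j = i")
      case True
      then show ?thesis
        using that[of "if i = Suc (Suc m) then 0 else i + 1"] * len by (auto simp: nth_append)
    next
      case False
      then show ?thesis
        using that[of i] * len by (auto simp: nth_append insert_commute)
    qed
    have IH: "f x = f y" if "x \<in> set (omit j s)" "y \<in> set (omit j s)" for x y
      by (rule Suc.IH[of T' "omit j s"]) (use Suc * j len that Suc.prems(3) in \<open>auto simp: length_omit\<close>)
    have "f z = f (s ! r)" if "z \<in> set s" for z
    proof -
      obtain l where l: "l < length s" "z = s ! l" using \<open>z \<in> set s\<close> unfolding in_set_conv_nth by blast
      show ?thesis
      proof (cases "l = j")
        case True
        then show ?thesis using Suc.prems(3)[OF r(3)] l by simp
      next
        case False
        then show ?thesis using IH nth_in_set_omit l r by blast
      qed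
    qed
    then show ?thesis using Suc.prems(4,5) by metis
  qed
qed simp

section \<open>Stars in the universal symbol\<close>

lemma sum_only:
  assumes "finite A" "\<And>i. i \<in> A \<Longrightarrow> i \<noteq> j \<Longrightarrow> h i = 0"
  shows "sum h A = (if j \<in> A then h j else (0 :: rat))"
proof -
  have "sum h A = (\<Sum>i\<in>A. if i = j then h i else 0)"
    by (rule sum.cong) (use assms in auto)
  then show ?thesis using assms(1) by simp
qed

lemma pairing_missing_vertex:
  assumes "\<And>T e. e \<in> set T \<Longrightarrow> t \<notin> e \<Longrightarrow> g T = 0" "t \<notin> set s" "length s = Suc m + 1"
  shows "pairing g (universal_symbol (Suc m) s) = 0"
proof (rule pairing_eq_0)
  fix T assume T: "T \<in> Poly_Mapping.keys (universal_symbol (Suc m) s)"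
  then have "T \<noteq> []" using length_universal_symbol by fastforce
  then have "hd T \<in> set T" by simp
  then show "g T = 0"
    using universal_symbol_edge_subset[OF T assms(3)] assms(1,2) by blast
qed

text \<open>The hypothesis on \<open>g\<close> says that only stars centred at \<open>t\<close> count.  Only the edge between the last
  vertex and \<open>t\<close>, which closes the cycle, can be appended to such a star.\<close>

lemma pairing_star_first:
  assumes "\<And>T e. e \<in> set T \<Longrightarrow> t \<notin> e \<Longrightarrow> g T = 0" "distinct (t # v)" "v \<noteq> []"
  shows "pairing g (universal_symbol (length v) (t # v)) = g (map (\<lambda>z. {t, z}) v)"
  using assms
proof (induction v arbitrary: g rule: rev_induct)
  case (snoc z v)
  show ?case
  proof (cases v)
    case Nil
    then show ?thesis by (simp add: edge_def)
  next
    case (Cons b v')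
    define m where "m = length v'"
    let ?s = "t # v @ [z]"
    let ?e = "\<lambda>i. {(?s @ [?s ! 0]) ! i, (?s @ [?s ! 0]) ! (i + 1)}"
    have len: "length v = Suc m" "length (v @ [z]) = Suc (Suc m)" using Cons m_def by auto
    have ne: "(?s @ [?s ! 0]) ! i \<noteq> t" if "1 \<le> i" "i \<le> Suc (Suc m)" for i
    proof -
      have "(?s @ [?s ! 0]) ! i = (v @ [z]) ! (i - 1)"
        using that len by (auto simp: nth_append nth_Cons split: nat.splits)
      moreover have "(v @ [z]) ! (i - 1) \<in> set (v @ [z])"
        using that len by (intro nth_mem) auto
      ultimately show ?thesis using snoc.prems(2) by auto
    qed
    have e0: "t \<notin> ?e i" if "1 \<le> i" "i \<le> Suc m" for i
      using ne[of i] ne[of "i + 1"] that by auto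
    have z: "pairing (\<lambda>T. g (T @ [?e i])) p = 0" if "1 \<le> i" "i \<le> Suc m" for i p
      using e0[OF that] by (intro pairing_eq_0 snoc.prems(1)[of "?e i"]) auto
    have "pairing g (universal_symbol (Suc (Suc m)) ?s) =
        pairing (\<lambda>T. g (T @ [?e (Suc (Suc m))])) (universal_symbol (Suc m) (omit (Suc (Suc m)) ?s))"
    proof -
      have "(\<Sum>i = 1..Suc m. pairing (\<lambda>T. g (T @ [?e i]))
          (universal_symbol (Suc m) (omit (i + 1) ?s))) = 0"
        by (intro sum.neutral ballI z) simp_all
      moreover have "(\<Sum>i = 1..Suc (Suc m). pairing (\<lambda>T. g (T @ [?e i]))
          (universal_symbol (Suc m) (omit i ?s))) =
        (if Suc (Suc m) \<in> {1..Suc (Suc m)} then pairing (\<lambda>T. g (T @ [?e (Suc (Suc m))]))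
          (universal_symbol (Suc m) (omit (Suc (Suc m)) ?s)) else 0)"
        by (rule sum_only[OF finite_atLeastAtMost], rule z) simp_all
      ultimately show ?thesis unfolding pairing_universal_symbol by simp
    qed
    also have "omit (Suc (Suc m)) ?s = t # v"
      using omit_append_Cons[of "t # v" z "[]"] len by simp
    also have "?e (Suc (Suc m)) = {t, z}"
      using len by (auto simp: nth_append)
    also have "pairing (\<lambda>T. g (T @ [{t, z}])) (universal_symbol (Suc m) (t # v)) =
        g (map (\<lambda>z. {t, z}) v @ [{t, z}])"
      unfolding len(1)[symmetric]
    proof (rule snoc.IH)
      show "g (T @ [{t, z}]) = 0" if "e \<in> set T" "t \<notin> e" for T e
        by (rule snoc.prems(1)[of e]) (use that in auto)
    qed (use snoc.prems(2) Cons in auto)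
    finally show ?thesis using len by simp
  qed
qed simp

text \<open>If \<open>t\<close> is not the first vertex, then two terms of the recursion survive: the first sum contributes the
  one that omits the vertex before \<open>t\<close> (unless this is \<open>a\<close>), the second one, with a minus sign, the one that
  omits the vertex after \<open>t\<close>.  These vertices are the last letters of \<open>u\<close> and of \<open>rev v\<close>, so
  this is the recursion of the shuffles by their last letter.\<close>

lemma pairing_star_later:
  assumes "\<And>T e. e \<in> set T \<Longrightarrow> t \<notin> e \<Longrightarrow> g T = 0" "distinct (a # u @ t # v)"
  shows "pairing g (universal_symbol (Suc (length u + length v)) (a # u @ t # v)) =
    (- 1) ^ length v * shuffle_sum (\<lambda>w. g (map (\<lambda>z. {t, z}) (a # w))) u (rev v)"
  using assms
proof (induction "length u + length v" arbitrary: g u v)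
  case 0
  then show ?case by (simp add: edge_def insert_commute)
next
  case (Suc m)
  let ?N = "Suc (Suc m)" and ?s = "a # u @ t # v"
  let ?k = "Suc (length u)"
  let ?e = "\<lambda>i. {(?s @ [?s ! 0]) ! i, (?s @ [?s ! 0]) ! (i + 1)}"
  let ?f = "\<lambda>w. g (map (\<lambda>z. {t, z}) (a # w))"
  have len: "length ?s = Suc ?N" using Suc.hyps(2) by simp
  have "?s ! ?k = t" by (simp add: nth_append)
  have pos: "(?s @ [?s ! 0]) ! i = t \<longleftrightarrow> i = ?k" if "i \<le> Suc ?N" for i
  proof (cases "i = Suc ?N")
    case True
    then have "(?s @ [?s ! 0]) ! i = a" using len by (metis nth_append_length nth_Cons_0)
    then show ?thesis using Suc.prems(2) Suc.hyps(2) True by auto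
  next
    case False
    then have i: "i < length ?s" using that len by simp
    then have "(?s @ [?s ! 0]) ! i = ?s ! i" by (simp only: nth_append if_True)
    moreover have "?k < length ?s" by simp
    ultimately show ?thesis
      using nth_eq_iff_index_eq[OF Suc.prems(2) i] \<open>?s ! ?k = t\<close> by metis
  qed
  have far: "pairing (\<lambda>T. g (T @ [?e i])) p = 0" if "1 \<le> i" "i \<le> ?N" "i \<noteq> ?k" "i + 1 \<noteq> ?k" for i p
  proof -
    have "t \<notin> ?e i" using pos[of i] pos[of "i + 1"] that by auto
    then show ?thesis by (intro pairing_eq_0 Suc.prems(1)[of "?e i"]) auto
  qed
  have omit_k: "omit ?k ?s = a # u @ v"
    using omit_append_Cons[of "a # u" t v] by simp
  have removed: "pairing (\<lambda>T. g (T @ [?e i])) (universal_symbol (Suc m) (omit ?k ?s)) = 0" for i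
    unfolding omit_k
  proof (rule pairing_missing_vertex[where t = t])
    show "g (T @ [?e i]) = 0" if "e \<in> set T" "t \<notin> e" for T e
      by (rule Suc.prems(1)[of e]) (use that in auto)
  qed (use Suc.prems(2) Suc.hyps(2) in auto)
  have "(\<Sum>i = 1..?N. pairing (\<lambda>T. g (T @ [?e i])) (universal_symbol (Suc m) (omit i ?s))) =
      (if length u \<in> {1..?N} then pairing (\<lambda>T. g (T @ [?e (length u)]))
        (universal_symbol (Suc m) (omit (length u) ?s)) else 0)"
  proof (rule sum_only)
    show "pairing (\<lambda>T. g (T @ [?e i])) (universal_symbol (Suc m) (omit i ?s)) = 0"
      if "i \<in> {1..?N}" "i \<noteq> length u" for i
      using far[of i] removed[of i] that by (cases "i = ?k") auto
  qed simp
  also have "\<dots> = (if u = [] then 0 else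
      (- 1) ^ length v * shuffle_sum (\<lambda>w. ?f (w @ [last u])) (butlast u) (rev v))"
  proof (cases u rule: rev_cases)
    case (snoc u' b)
    have "omit (length u) ?s = a # u' @ t # v"
      using omit_append_Cons[of "a # u'" b "t # v"] snoc by simp
    moreover have "?e (length u) = {t, b}" using snoc by (auto simp: nth_append)
    moreover have "pairing (\<lambda>T. g (T @ [{t, b}])) (universal_symbol (Suc (length u' + length v)) (a # u' @ t # v)) =
      (- 1) ^ length v * shuffle_sum (\<lambda>w. g (map (\<lambda>z. {t, z}) (a # w) @ [{t, b}])) u' (rev v)"
    proof (rule Suc.hyps(1))
      show "g (T @ [{t, b}]) = 0" if "e \<in> set T" "t \<notin> e" for T e
        by (rule Suc.prems(1)[of e]) (use that in auto)
    qed (use Suc.hyps(2) Suc.prems(2) snoc in auto)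
    moreover have "length u' + length v = m" using Suc.hyps(2) snoc by simp
    ultimately show ?thesis using snoc by simp
  qed simp
  finally have sum1: "(\<Sum>i = 1..?N. pairing (\<lambda>T. g (T @ [?e i])) (universal_symbol (Suc m) (omit i ?s))) =
      (if u = [] then 0 else
        (- 1) ^ length v * shuffle_sum (\<lambda>w. ?f (w @ [last u])) (butlast u) (rev v))" .
  have "(\<Sum>i = 1..Suc m. pairing (\<lambda>T. g (T @ [?e i])) (universal_symbol (Suc m) (omit (i + 1) ?s))) =
      (if ?k \<in> {1..Suc m} then pairing (\<lambda>T. g (T @ [?e ?k]))
        (universal_symbol (Suc m) (omit (?k + 1) ?s)) else 0)"
  proof (rule sum_only)
    show "pairing (\<lambda>T. g (T @ [?e i])) (universal_symbol (Suc m) (omit (i + 1) ?s)) = 0"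
      if "i \<in> {1..Suc m}" "i \<noteq> ?k" for i
      using far[of i] removed[of i] that by (cases "i + 1 = ?k") auto
  qed simp
  also have "\<dots> = (if v = [] then 0 else
      - ((- 1) ^ length v * shuffle_sum (\<lambda>w. ?f (w @ [hd v])) u (rev (tl v))))"
  proof (cases v)
    case Nil
    then show ?thesis using Suc.hyps(2) by simp
  next
    case (Cons d v')
    have "omit (?k + 1) ?s = a # u @ t # v'"
      using omit_append_Cons[of "a # u @ [t]" d v'] Cons by simp
    moreover have "?e ?k = {t, d}" using Cons by (auto simp: nth_append)
    moreover have "pairing (\<lambda>T. g (T @ [{t, d}])) (universal_symbol (Suc (length u + length v')) (a # u @ t # v')) =
      (- 1) ^ length v' * shuffle_sum (\<lambda>w. g (map (\<lambda>z. {t, z}) (a # w) @ [{t, d}])) u (rev v')"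
    proof (rule Suc.hyps(1))
      show "g (T @ [{t, d}]) = 0" if "e \<in> set T" "t \<notin> e" for T e
        by (rule Suc.prems(1)[of e]) (use that in auto)
    qed (use Suc.hyps(2) Suc.prems(2) Cons in auto)
    moreover have "length u + length v' = m" using Suc.hyps(2) Cons by simp
    ultimately show ?thesis using Cons by simp
  qed
  finally have sum2: "(\<Sum>i = 1..Suc m. pairing (\<lambda>T. g (T @ [?e i])) (universal_symbol (Suc m) (omit (i + 1) ?s))) =
      (if v = [] then 0 else
        - ((- 1) ^ length v * shuffle_sum (\<lambda>w. ?f (w @ [hd v])) u (rev (tl v))))" .
  have "pairing g (universal_symbol ?N ?s) = (- 1) ^ length v * shuffle_sum ?f u (rev v)"
    unfolding pairing_universal_symbol sum1 sum2
  proof (cases u rule: rev_cases; cases v)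
    fix u' b d v' assume "u = u' @ [b]" "v = d # v'"
    then show "(if u = [] then 0 else
          (- 1) ^ length v * shuffle_sum (\<lambda>w. ?f (w @ [last u])) (butlast u) (rev v)) -
        (if v = [] then 0 else
          - ((- 1) ^ length v * shuffle_sum (\<lambda>w. ?f (w @ [hd v])) u (rev (tl v)))) =
        (- 1) ^ length v * shuffle_sum ?f u (rev v)"
      by (simp add: shuffle_sum_snoc distrib_left)
  qed (use Suc.hyps(2) in auto)
  then show ?case using Suc.hyps(2) by simp
qed

section \<open>Functionals satisfying the decomposition relations\<close>

locale decomposition_functional =
  fixes n :: nat and c :: "'a::field list \<Rightarrow> rat"
  assumes n_pos: "1 \<le> n"
    and decomposition: "xs \<in> tuples n \<Longrightarrow> ys \<in> tuples n \<Longrightarrow>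
      c xs - c ys = pairing
        (\<lambda>T. if \<forall>e\<in>set T. edge_diff ys e \<noteq> 0
          then c (0 # map (\<lambda>e. edge_diff xs e / edge_diff ys e) T) else 0)
        (universal_symbol n [0..<n + 1])"
begin

text \<open>The nonzero entry is \<open>-1\<close> so that the ratio belonging to the edge from \<open>k\<close> to \<open>i\<close> is
  \<open>x\<^sub>i - x\<^sub>k\<close>.\<close>

definition star_tuple :: "nat \<Rightarrow> 'a list" where
  "star_tuple k = replicate k 0 @ - 1 # replicate (n - k) 0"

lemma star_tuple_in_tuples: "k \<le> n \<Longrightarrow> star_tuple k \<in> tuples n"
proof -
  assume "k \<le> n"
  moreover have "0 \<in> set (star_tuple k)"
    using n_pos \<open>k \<le> n\<close> by (auto simp: star_tuple_def)
  moreover have "- 1 \<in> set (star_tuple k)" by (simp add: star_tuple_def)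
  moreover have "(0 :: 'a) \<noteq> - 1" by simp
  ultimately show ?thesis unfolding tuples_def by (auto simp: star_tuple_def)
qed

lemma star_tuple_nth: "k \<le> n \<Longrightarrow> i \<le> n \<Longrightarrow> star_tuple k ! i = (if i = k then - 1 else 0)"
  by (auto simp: star_tuple_def nth_append nth_Cons split: nat.splits)

lemma edge_diff_star_tuple:
  assumes "k \<le> n" "i \<le> n" "i \<noteq> k"
  shows "edge_diff (star_tuple k) {k, i} \<noteq> 0"
    and "edge_diff xs {k, i} / edge_diff (star_tuple k) {k, i} = xs ! i - xs ! k"
  using assms by (cases i k rule: linorder_cases; simp add: edge_diff_def star_tuple_nth)+

lemma edge_diff_star_tuple_eq_0:
  assumes "k \<le> n" "e \<noteq> {}" "e \<subseteq> {..n}" "k \<notin> e"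
  shows "edge_diff (star_tuple k) e = 0"
proof -
  have "finite e" using assms(3) finite_subset by blast
  then have "Min e \<in> e" "Max e \<in> e" using assms(2) by auto
  then show ?thesis using assms by (auto simp: edge_diff_def star_tuple_nth subset_iff)
qed

text \<open>The summand of the decomposition relation for \<open>star_tuple k\<close>.  The condition \<open>k \<in> e\<close> follows
  from the other one for edges inside \<open>{0..n}\<close>; stating it makes the function vanish away
  from the stars at \<open>k\<close> on all words, as the lemmas on stars require.\<close>

definition star_value :: "nat \<Rightarrow> 'a list \<Rightarrow> nat set list \<Rightarrow> rat" where
  "star_value k xs T =
    (if \<forall>e\<in>set T. k \<in> e \<and> edge_diff (star_tuple k) e \<noteq> 0
     then c (0 # map (\<lambda>e. edge_diff xs e / edge_diff (star_tuple k) e) T) else 0)"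

lemma star_value_eq_0: "e \<in> set T \<Longrightarrow> k \<notin> e \<Longrightarrow> star_value k xs T = 0"
  by (auto simp: star_value_def)

lemma star_value_star:
  assumes "k \<le> n" "\<And>i. i \<in> set w \<Longrightarrow> i \<le> n \<and> i \<noteq> k"
  shows "star_value k xs (map (\<lambda>i. {k, i}) w) = c (0 # map (\<lambda>i. xs ! i - xs ! k) w)"
proof -
  have eq: "map (\<lambda>e. edge_diff xs e / edge_diff (star_tuple k) e) (map (\<lambda>i. {k, i}) w) =
      map (\<lambda>i. xs ! i - xs ! k) w"
    using assms edge_diff_star_tuple(2) by simp
  have star: "\<forall>e\<in>set (map (\<lambda>i. {k, i}) w). k \<in> e \<and> edge_diff (star_tuple k) e \<noteq> 0"
    using assms edge_diff_star_tuple(1) by auto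
  show ?thesis by (simp only: star_value_def if_P[OF star] eq)
qed

lemma star_decomposition:
  assumes "xs \<in> tuples n" "k \<le> n"
  shows "c xs - c (star_tuple k) = pairing (star_value k xs) (universal_symbol n [0..<n + 1])"
  unfolding decomposition[OF assms(1) star_tuple_in_tuples[OF assms(2)]] pairing_def
proof (intro sum.cong refl arg_cong2[where f = "(*)"])
  fix T assume T: "T \<in> Poly_Mapping.keys (universal_symbol n [0..<n + 1])"
  have "k \<in> e" if "e \<in> set T" "edge_diff (star_tuple k) e \<noteq> 0" for e
  proof (rule ccontr)
    assume "k \<notin> e"
    moreover have "e \<noteq> {} \<and> e \<subseteq> set [0..<n + 1]"
      by (rule universal_symbol_edge_subset[OF T _ that(1)]) simp
    ultimately have "edge_diff (star_tuple k) e = 0"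
      by (intro edge_diff_star_tuple_eq_0[OF assms(2)]) auto
    then show False using that(2) by simp
  qed
  then show "(if \<forall>e\<in>set T. edge_diff (star_tuple k) e \<noteq> 0
      then c (0 # map (\<lambda>e. edge_diff xs e / edge_diff (star_tuple k) e) T) else 0) =
    star_value k xs T"
    by (auto simp: star_value_def)
qed

lemma star_first:
  assumes "xs \<in> tuples n"
  shows "c xs - c (star_tuple 0) = c (map (\<lambda>x. x - hd xs) xs)"
proof -
  have len: "length xs = Suc n" using assms by (simp add: tuples_def)
  then have hd: "xs ! 0 = hd xs" by (intro hd_conv_nth[symmetric]) auto
  have upt: "[0..<n + 1] = 0 # [1..<n + 1]" by (simp add: upt_conv_Cons del: upt_Suc)
  have "c xs - c (star_tuple 0) =
      pairing (star_value 0 xs) (universal_symbol (length [1..<n + 1]) (0 # [1..<n + 1]))"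
    using star_decomposition[OF assms, of 0] unfolding upt by (simp del: upt_Suc)
  also have "\<dots> = star_value 0 xs (map (\<lambda>i. {0, i}) [1..<n + 1])"
    by (rule pairing_star_first) (use n_pos star_value_eq_0 in auto)
  also have "\<dots> = c (0 # map (\<lambda>i. xs ! i - xs ! 0) [1..<n + 1])"
    by (rule star_value_star) auto
  also have "0 # map (\<lambda>i. xs ! i - xs ! 0) [1..<n + 1] = map (\<lambda>i. xs ! i - xs ! 0) [0..<n + 1]"
    unfolding upt by (simp del: upt_Suc)
  also have "\<dots> = map (\<lambda>x. x - hd xs) xs"
    using len hd by (intro nth_equalityI) (simp_all del: upt_Suc)
  finally show ?thesis .
qed

text \<open>For \<open>z = (0, 1, \<dots>, 1)\<close>, comparing \<open>star_tuple 0\<close> with itself gives \<open>c z = 0\<close>, because \<open>star_tuple 0\<close> is a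
  translate of \<open>z\<close>.  As \<open>z\<close> is its own normalisation, it also gives \<open>c z - c (star_tuple 0) = c z\<close>.\<close>

lemma c_star_tuple_0: "c (star_tuple 0) = 0"
proof -
  let ?z = "0 # replicate n 1 :: 'a list"
  have z: "?z \<in> tuples n" using n_pos by (auto simp: tuples_def)
  have "map (\<lambda>x. x - hd (star_tuple 0)) (star_tuple 0) = ?z" by (simp add: star_tuple_def)
  then have "c ?z = 0" using star_first[OF star_tuple_in_tuples[of 0]] by simp
  moreover have "map (\<lambda>x. x - hd ?z) ?z = ?z" by simp
  ultimately show ?thesis using star_first[OF z] by simp
qed

lemma c_normalise: "xs \<in> tuples n \<Longrightarrow> c xs = c (map (\<lambda>x. x - hd xs) xs)"
  using star_first c_star_tuple_0 by simp

lemma homogeneity: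
  assumes "xs \<in> tuples n"
  shows "c (map (\<lambda>x. x + b) xs) = c xs"
proof -
  have "map (\<lambda>x. x + b) xs \<in> tuples n" using assms by (auto simp: tuples_def)
  moreover have "xs \<noteq> []" using assms by (auto simp: tuples_def)
  ultimately show ?thesis
    using c_normalise[OF assms] c_normalise[of "map (\<lambda>x. x + b) xs"]
    by (simp add: hd_map comp_def)
qed

lemma star_later:
  assumes "a # u @ t # v \<in> tuples n"
  shows "c (a # u @ t # v) - c (star_tuple (Suc (length u))) =
    (- 1) ^ length v * shuffle_sum (\<lambda>w. c (t # a # w)) u (rev v)"
proof -
  let ?xs = "a # u @ t # v"
  define k where "k = Suc (length u)"
  have n: "n = Suc (length u + length v)" using assms by (simp add: tuples_def)
  have k: "k \<le> n" "1 \<le> k" using n by (auto simp: k_def)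
  let ?u = "[1..<k]" and ?v = "[k + 1..<n + 1]"
  have upt: "[0..<n + 1] = 0 # ?u @ k # ?v"
  proof -
    have "[0..<n + 1] = [0..<k] @ [k..<n + 1]" 
      using k upt_add_eq_append[of 0 k "n + 1 - k"] by (simp del: upt_Suc)
    then show ?thesis using k by (simp add: upt_conv_Cons del: upt_Suc)
  qed
  have t: "?xs ! k = t" by (simp add: k_def nth_append)
  have u: "map ((!) ?xs) ?u = u"
    by (rule nth_equalityI) (auto simp: k_def nth_append simp del: upt_Suc)
  have v: "map ((!) ?xs) ?v = v"
    by (rule nth_equalityI) (auto simp: k_def n nth_append simp del: upt_Suc)
  have len: "length ?u = length u" "length ?v = length v" 
    unfolding length_upt using n by (auto simp: k_def)
  have "c ?xs - c (star_tuple k) = pairing (star_value k ?xs)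
      (universal_symbol (Suc (length ?u + length ?v)) (0 # ?u @ k # ?v))"
    using star_decomposition[OF assms k(1)] unfolding upt len n[symmetric] by (simp del: upt_Suc)
  also have "\<dots> = (- 1) ^ length ?v *
      shuffle_sum (\<lambda>w. star_value k ?xs (map (\<lambda>i. {k, i}) (0 # w))) ?u (rev ?v)"
    by (rule pairing_star_later) (use star_value_eq_0 k in auto)
  also have "shuffle_sum (\<lambda>w. star_value k ?xs (map (\<lambda>i. {k, i}) (0 # w))) ?u (rev ?v) =
      shuffle_sum (\<lambda>w. c (t # a # map ((!) ?xs) w)) ?u (rev ?v)"
  proof (rule shuffle_sum_cong)
    fix w assume w: "set w = set ?u \<union> set (rev ?v)" "length w = length ?u + length (rev ?v)"
    have "star_value k ?xs (map (\<lambda>i. {k, i}) (0 # w)) = c (0 # map (\<lambda>i. ?xs ! i - ?xs ! k) (0 # w))"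
      using k w by (intro star_value_star) auto
    also have "\<dots> = c (map (\<lambda>x. x - hd (t # a # map ((!) ?xs) w)) (t # a # map ((!) ?xs) w))"
      using t by (simp add: comp_def)
    also have "\<dots> = c (t # a # map ((!) ?xs) w)"
    proof (rule c_normalise[symmetric])
      have "(!) ?xs ` set w = set u \<union> set v"
        using w(1) arg_cong[OF u, of set] arg_cong[OF v, of set] by (simp add: image_Un)
      then have "set (t # a # map ((!) ?xs) w) = set ?xs" by auto
      moreover have "length (t # a # map ((!) ?xs) w) = n + 1" using w(2) len n by simp
      ultimately show "t # a # map ((!) ?xs) w \<in> tuples n"
        using assms unfolding tuples_def by (simp only: mem_Collect_eq)
    qed
    finally show "star_value k ?xs (map (\<lambda>i. {k, i}) (0 # w)) = c (t # a # map ((!) ?xs) w)" .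
  qed
  also have "\<dots> = shuffle_sum (\<lambda>w. c (t # a # w)) (map ((!) ?xs) ?u) (map ((!) ?xs) (rev ?v))"
    by (rule shuffle_sum_map[symmetric])
  also have "\<dots> = shuffle_sum (\<lambda>w. c (t # a # w)) u (rev v)"
    by (simp only: u v rev_map[symmetric])
  finally show ?thesis unfolding len unfolding k_def .
qed

lemma tuples_rotate: "xs \<in> tuples n \<Longrightarrow> rotate m xs \<in> tuples n"
  by (simp add: tuples_def)

text \<open>This is \<open>star_later\<close> for the last vertex: \<open>v\<close> is empty, and there is only one shuffle.\<close>

lemma rotate1_up_to_constant:
  assumes "xs \<in> tuples n"
  shows "c (rotate1 xs) = c xs + c (star_tuple n)"
proof -
  have "length xs = Suc n" using assms by (simp add: tuples_def)
  then obtain t a u where xs: "xs = t # a # u" "length u = n - 1"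
    using n_pos by (cases xs; cases "tl xs") auto
  have "a # u @ [t] \<in> tuples n"
    using tuples_rotate[OF assms, of 1] xs by simp
  from star_later[OF this] show ?thesis using xs n_pos by simp
qed

text \<open>Going once around the orbit of a tuple adds the constant \<open>n + 1\<close> times and returns to the start.
  Here it is used that the coefficients are rational.\<close>

lemma c_star_tuple_n: "c (star_tuple n) = 0"
proof -
  let ?x = "star_tuple 0"
  have x: "?x \<in> tuples n" by (simp add: star_tuple_in_tuples)
  have "c (rotate m ?x) = c ?x + of_nat m * c (star_tuple n)" for m
    by (induction m) (simp_all add: rotate1_up_to_constant tuples_rotate[OF x] distrib_right)
  moreover have "rotate (n + 1) ?x = ?x"
    using x by (intro rotate_id) (simp add: tuples_def)
  ultimately have "of_nat (n + 1) * c (star_tuple n) = 0"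
    by (metis add_cancel_right_right)
  then show ?thesis by (simp del: of_nat_add of_nat_Suc)
qed

lemma cyclic: "xs \<in> tuples n \<Longrightarrow> c (rotate1 xs) = c xs"
  using rotate1_up_to_constant c_star_tuple_n by simp

lemma cyclic_rotate: "xs \<in> tuples n \<Longrightarrow> c (rotate m xs) = c xs"
  by (induction m) (simp_all add: cyclic tuples_rotate)

text \<open>The tuples \<open>star_tuple k\<close> are rotations of each other.\<close>

lemma c_star_tuple: "k \<le> n \<Longrightarrow> c (star_tuple k) = 0"
proof -
  assume k: "k \<le> n"
  have "rotate (length (replicate k (0 :: 'a))) (star_tuple k) =
      (- 1 # replicate (n - k) 0) @ replicate k 0"
    unfolding star_tuple_def by (rule rotate_append)
  also have "\<dots> = star_tuple 0"
    using k by (simp add: star_tuple_def replicate_add[symmetric])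
  finally show ?thesis
    using cyclic_rotate[OF star_tuple_in_tuples[OF k], of k] c_star_tuple_0 by simp
qed

text \<open>The constant in \<open>star_later\<close> is zero, and the left side may be rotated so that \<open>t\<close> comes first.\<close>

lemma reflection:
  assumes "t # v @ a # u \<in> tuples n"
  shows "c (t # v @ a # u) = (- 1) ^ length v * shuffle_sum (\<lambda>w. c (t # a # w)) u (rev v)"
proof -
  have rot: "rotate (length (t # v)) (t # v @ a # u) = a # u @ t # v"
    using rotate_append[of "t # v" "a # u"] by simp
  then have tup: "a # u @ t # v \<in> tuples n"
    using tuples_rotate[OF assms] by metis
  then have "Suc (length u) \<le> n" by (simp add: tuples_def)
  then show ?thesis
    using star_later[OF tup] c_star_tuple cyclic_rotate[OF assms, of "length (t # v)"] rot by simp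
qed

text \<open>The shuffles of \<open>a # u'\<close> and \<open>b # v'\<close> that start with \<open>a\<close>, and those that start with \<open>b\<close>, are
  the right sides of two instances of \<open>reflection\<close>.  The left sides belong to the same tuple
  \<open>t # rev v' @ b # a # u'\<close>, once read with \<open>a\<close> and once with \<open>b\<close> as the distinguished letter.
  The numbers of letters before the distinguished one differ by \<open>1\<close>, so the signs are opposite.\<close>

lemma shuffle:
  assumes "t # u @ v \<in> tuples n" "u \<noteq> []" "v \<noteq> []"
  shows "shuffle_sum (\<lambda>w. c (t # w)) u v = 0"
proof -
  obtain a u' b v' where uv: "u = a # u'" "v = b # v'"
    using assms(2,3) by (cases u; cases v) auto
  have tup: "t # rev v' @ b # a # u' \<in> tuples n"
    using assms(1) uv by (simp add: tuples_def) blast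
  have "shuffle_sum (\<lambda>w. c (t # b # w)) (a # u') v' = (- 1) ^ length v' * c (t # rev v' @ b # a # u')"
    using reflection[OF tup] by (simp add: mult.assoc[symmetric] power_mult_distrib[symmetric])
  moreover have "shuffle_sum (\<lambda>w. c (t # a # w)) u' (b # v') =
      - ((- 1) ^ length v' * c (t # rev v' @ b # a # u'))"
    using reflection[of t "rev v' @ [b]" a u'] tup
    by (simp add: mult.assoc[symmetric] power_mult_distrib[symmetric])
  ultimately show ?thesis by (simp add: uv)
qed

end

section \<open>The presentation\<close>

text \<open>If all the ratios belonging to a tree were zero, then \<open>xs\<close> would agree at the ends of every edge,
  and so would have all entries equal.\<close>

lemma decomposition_relations_subset:
  "decomposition_relations n \<subseteq> (free_on (tuples n) :: ('a::field list \<Rightarrow>\<^sub>0 rat) set)"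
proof -
  have "0 # map (\<lambda>e. edge_diff xs e / edge_diff ys e) T \<in> tuples n"
    if xs: "xs \<in> tuples n" and T: "T \<in> signed_trees n" "\<forall>e\<in>set T. edge_diff ys e \<noteq> 0"
    for xs ys :: "'a list" and T
  proof -
    have keys: "T \<in> Poly_Mapping.keys (universal_symbol n [0..<n + 1])"
      using T(1) by (simp add: signed_trees_def)
    have "\<exists>e\<in>set T. edge_diff xs e \<noteq> 0"
    proof (rule ccontr)
      assume "\<not> (\<exists>e\<in>set T. edge_diff xs e \<noteq> 0)"
      then have edge: "edge_diff xs {i, j} = 0" if "{i, j} \<in> set T" for i j
        using that by blast
      have "xs ! i = xs ! j" if "{i, j} \<in> set T" for i j
        using edge[OF that] by (cases i j rule: linorder_cases) (auto simp: edge_diff_def)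
      note connected = universal_symbol_connected[OF keys _ this]
      have "xs ! i = xs ! j" if "i \<le> n" "j \<le> n" for i j
        by (rule connected) (use that in auto)
      then show False using xs by (auto simp: tuples_def in_set_conv_nth)
    qed
    then obtain e where "e \<in> set T" "edge_diff xs e \<noteq> 0" by blast
    then show ?thesis
      using T(2) length_universal_symbol[OF keys]
      by (auto simp: tuples_def intro!: bexI[of _ e])
  qed
  then show ?thesis
    by (auto simp: decomposition_relations_def decomposition_relation_def
        intro!: free.subspace_diff[OF subspace_free_on] free.subspace_sum[OF subspace_free_on]
          free.subspace_scale[OF subspace_free_on])
qed

lemma correlator_relations_in_span:
  assumes "n \<ge> 1"
  shows "correlator_relations n \<subseteq> free.span (decomposition_relations n :: ('a::field list \<Rightarrow>\<^sub>0 rat) set)"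
proof
  fix r :: "'a list \<Rightarrow>\<^sub>0 rat" assume r: "r \<in> correlator_relations n"
  show "r \<in> free.span (decomposition_relations n)"
  proof (rule in_span_if_functionals_vanish)
    fix \<phi> :: "('a list \<Rightarrow>\<^sub>0 rat) \<Rightarrow> rat"
    assume linear: "Vector_Spaces.linear free_scale (*) \<phi>"
      and zero: "\<And>d. d \<in> decomposition_relations n \<Longrightarrow> \<phi> d = 0"
    interpret \<phi>: Vector_Spaces.linear free_scale "(*)" \<phi> by (rule linear)
    define c where "c xs = \<phi> (gen xs)" for xs
    interpret decomposition_functional n c
    proof
      fix xs ys :: "'a list" assume "xs \<in> tuples n" "ys \<in> tuples n"
      then have "\<phi> (decomposition_relation n xs ys) = 0"
        by (intro zero) (auto simp: decomposition_relations_def)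
      then have "c xs - c ys = (\<Sum>T | T \<in> signed_trees n \<and> (\<forall>e\<in>set T. edge_diff ys e \<noteq> 0).
          tree_sgn n T * c (0 # map (\<lambda>e. edge_diff xs e / edge_diff ys e) T))"
        by (simp add: decomposition_relation_def \<phi>.diff \<phi>.sum \<phi>.scale c_def)
      also have "\<dots> = (\<Sum>T\<in>signed_trees n. if \<forall>e\<in>set T. edge_diff ys e \<noteq> 0
          then tree_sgn n T * c (0 # map (\<lambda>e. edge_diff xs e / edge_diff ys e) T) else 0)"
        by (rule sum.inter_filter) (simp add: signed_trees_def)
      finally show "c xs - c ys = pairing
          (\<lambda>T. if \<forall>e\<in>set T. edge_diff ys e \<noteq> 0
            then c (0 # map (\<lambda>e. edge_diff xs e / edge_diff ys e) T) else 0)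
          (universal_symbol n [0..<n + 1])"
        unfolding pairing_def signed_trees_def tree_sgn_def by (simp add: if_distrib cong: if_cong)
    qed (rule assms)
    from r consider "r \<in> homogeneity_relations n" | "r \<in> cyclic_relations n"
      | "r \<in> shuffle_relations n" | "r \<in> decomposition_relations n"
      by (auto simp: correlator_relations_def)
    then show "\<phi> r = 0"
    proof cases
      case 1
      then show ?thesis
        using homogeneity by (auto simp: homogeneity_relations_def \<phi>.diff c_def)
    next
      case 2
      then show ?thesis
        using cyclic by (auto simp: cyclic_relations_def \<phi>.diff c_def)
    next
      case 3
      then obtain xs p q where *: "xs \<in> tuples n" "p > 0" "q > 0" "n = p + q"
        and r: "r = (\<Sum>\<sigma>\<in>Sh p q. gen (xs ! 0 # map (\<lambda>i. xs ! \<sigma> i) [1..<n + 1]))"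
        by (auto simp: shuffle_relations_def)
      let ?u = "map ((!) xs) [1..<p + 1]" and ?v = "map ((!) xs) [p + 1..<p + q + 1]"
      have "\<phi> r = (\<Sum>\<sigma>\<in>Sh p q. c (xs ! 0 # map ((!) xs) (map \<sigma> [1..<p + q + 1])))"
        by (simp add: r \<phi>.sum c_def *(4) comp_def del: upt_Suc)
      also have "\<dots> = shuffle_sum (\<lambda>w. c (xs ! 0 # map ((!) xs) w)) [1..<p + 1] [p + 1..<p + q + 1]"
        by (rule sum_Sh_eq_shuffle_sum)
      also have "\<dots> = shuffle_sum (\<lambda>w. c (xs ! 0 # w)) ?u ?v"
        by (rule shuffle_sum_map[symmetric])
      also have "\<dots> = 0"
      proof (rule shuffle)
        have len: "length xs = p + q + 1" using *(1,4) by (simp add: tuples_def)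
        have "[0..<p + q + 1] = 0 # [1..<p + 1] @ [p + 1..<p + q + 1]"
          using upt_add_eq_append[of 1 "p + 1" q]
          by (simp add: upt_conv_Cons add.commute add.left_commute del: upt_Suc)
        then have "xs = xs ! 0 # ?u @ ?v"
          using map_nth[of xs] len by (metis list.simps(9) map_append)
        then show "xs ! 0 # ?u @ ?v \<in> tuples n" using *(1) by simp
      qed (use *(2,3) in auto)
      finally show ?thesis .
    next
      case 4
      then show ?thesis by (rule zero)
    qed
  qed
qed

theorem mainTheorem1:
  fixes n :: nat
  assumes "n \<ge> 1"
  shows "(Cor_linear :: ('a::field list \<Rightarrow>\<^sub>0 rat) \<Rightarrow> 'a goncharov) ` free_on (tuples n) = goncharov_weight n
    \<and> {v \<in> free_on (tuples n). Cor_linear v = (0 :: 'a goncharov)} = free.span (decomposition_relations n)"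
proof -
  let ?D = "decomposition_relations n :: ('a list \<Rightarrow>\<^sub>0 rat) set"
  have "free.span (correlator_relations n) = free.span ?D"
  proof
    show "free.span (correlator_relations n) \<subseteq> free.span ?D"
      by (intro free.span_minimal correlator_relations_in_span assms free.subspace_span)
    show "free.span ?D \<subseteq> free.span (correlator_relations n)"
      by (intro free.span_mono) (auto simp: correlator_relations_def)
  qed
  moreover have "free.span ?D \<subseteq> free_on (tuples n)"
    by (intro free.span_minimal decomposition_relations_subset subspace_free_on)
  ultimately show ?thesis
    using goncharov_weight_presentation[OF assms, where 'a = 'a] by blast
qed

end
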